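(* Let $T_0$ be a nondegenerate closed triangle in the plane. For every $n\ge 1$, the lengths of the outer circumference path $Out_n$ and of the inner circumference path $Inn_n$ of $T_0$ are: (1) $|Out_n|=3n\cdot 2^n$; (2) $|Inn_n|=3\cdot 2^n$.
   Context: For a triangle $T$ with barycenter $b$, $B(T)$ is the collection of the six closed triangles $[v,m,b]$, where $v$ is a vertex of $T$ and $m$ is the midpoint of a side of $T$ containing $v$. For a collection $C$ of triangles $B(C)=\bigcup_{c\in C}B(c)$; $B^0(T_0)=\{T_0\}$, $B^n(T_0)=B(B^{n-1}(T_0))$. $B^n(T_0)$ is regarded as the vertex set of a graph in which two distinct triangles are joined by an edge if and only if they share a side. $Y_n$ is the set of level $n$ boundary triangles of $T_0$, i.e. those $t\in B^n(T_0)$ having a side that lies on the boundary $\partial T_0$. $Z_n$ is the set of all $t\in B^n(T_0)$ such that $t$ intersects $\partial T_0$ in exactly one point. $Out_n$ is the cycle in this graph that passes through each triangle in $Y_n$ and $Z_n$ (and no others). $Inn_n$ is the cycle that passes through each triangle of $B^n(T_0)$ containing the barycenter of $T_0$ as a vertex (and no others). The length $|\cdot|$ of a cycle is its number of edges (equivalently, of triangles it passes through). *)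

theory Defs
  imports "HOL-Analysis.Analysis"
begin

section \<open>Triangles and barycentric subdivision\<close>

text \<open>
  A nondegenerate closed triangle is a set \<open>T\<close> of points with \<open>2 simplex T\<close>; the functions below
  are only meaningful on such sets.  Triangles are compared as point sets, and the vertices are
  recovered from the point set as its extreme points.
\<close>

type_synonym plane = "real ^ 2"

definition vertices :: "plane set \<Rightarrow> plane set" where
  "vertices T = {v. v extreme_point_of T}"

definition sides :: "plane set \<Rightarrow> plane set set" where
  "sides T = {closed_segment v w | v w. v \<in> vertices T \<and> w \<in> vertices T \<and> v \<noteq> w}"

definition barycenter :: "plane set \<Rightarrow> plane" where
  "barycenter T = (1 / 3) *\<^sub>R (\<Sum>v\<in>vertices T. v)"

text \<open>The sides containing the vertex \<open>v\<close> are the segments from \<open>v\<close> to the other vertices \<open>w\<close>.\<close>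

definition barycentric_division :: "plane set \<Rightarrow> plane set set" where
  "barycentric_division T =
     {convex hull {v, midpoint v w, barycenter T} | v w.
        v \<in> vertices T \<and> w \<in> vertices T \<and> v \<noteq> w}"

definition barycentric_division_family :: "plane set set \<Rightarrow> plane set set" where
  "barycentric_division_family C = (\<Union>T\<in>C. barycentric_division T)"

definition subdivision :: "nat \<Rightarrow> plane set \<Rightarrow> plane set set" where
  "subdivision n T\<^sub>0 = (barycentric_division_family ^^ n) {T\<^sub>0}"


section \<open>Cycles in the graph of a family of triangles\<close>

definition adjacency_edges :: "plane set set \<Rightarrow> plane set set set" where
  "adjacency_edges C = {{s, t} | s t. s \<in> C \<and> t \<in> C \<and> s \<noteq> t \<and> sides s \<inter> sides t \<noteq> {}}"

text \<open>
  Cycles are subgraphs: a cycle is represented by its set of edges, so that rotating or reversing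
  the vertex list yields the same cycle.  Its length is the cardinality of this set, and the
  vertices it passes through form its union.
\<close>

definition is_cycle :: "'a set set \<Rightarrow> 'a set set \<Rightarrow> bool" where
  "is_cycle E K \<longleftrightarrow> K \<subseteq> E \<and>
     (\<exists>xs. distinct xs \<and> length xs \<ge> 3 \<and>
           K = {{xs ! i, xs ! (Suc i mod length xs)} | i. i < length xs})"

definition cycle_through :: "'a set set \<Rightarrow> 'a set \<Rightarrow> 'a set set \<Rightarrow> bool" where
  "cycle_through E A K \<longleftrightarrow> is_cycle E K \<and> \<Union>K = A"

definition cycle_length :: "'a set set \<Rightarrow> nat" where
  "cycle_length K = card K"


section \<open>Outer and inner circumference paths\<close>

definition boundary_triangles :: "nat \<Rightarrow> plane set \<Rightarrow> plane set set" where
  "boundary_triangles n T\<^sub>0 = {t \<in> subdivision n T\<^sub>0. \<exists>e\<in>sides t. e \<subseteq> frontier T\<^sub>0}"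

definition point_contact_triangles :: "nat \<Rightarrow> plane set \<Rightarrow> plane set set" where
  "point_contact_triangles n T\<^sub>0 = {t \<in> subdivision n T\<^sub>0. \<exists>x. t \<inter> frontier T\<^sub>0 = {x}}"

definition central_triangles :: "nat \<Rightarrow> plane set \<Rightarrow> plane set set" where
  "central_triangles n T\<^sub>0 = {t \<in> subdivision n T\<^sub>0. barycenter T\<^sub>0 \<in> vertices t}"

definition is_Out :: "nat \<Rightarrow> plane set \<Rightarrow> plane set set set \<Rightarrow> bool" where
  "is_Out n T\<^sub>0 = cycle_through (adjacency_edges (subdivision n T\<^sub>0))
     (boundary_triangles n T\<^sub>0 \<union> point_contact_triangles n T\<^sub>0)"

definition is_Inn :: "nat \<Rightarrow> plane set \<Rightarrow> plane set set set \<Rightarrow> bool" where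
  "is_Inn n T\<^sub>0 = cycle_through (adjacency_edges (subdivision n T\<^sub>0)) (central_triangles n T\<^sub>0)"

definition Out :: "nat \<Rightarrow> plane set \<Rightarrow> plane set set set" where
  "Out n T\<^sub>0 = (THE K. is_Out n T\<^sub>0 K)"

definition Inn :: "nat \<Rightarrow> plane set \<Rightarrow> plane set set set" where
  "Inn n T\<^sub>0 = (THE K. is_Inn n T\<^sub>0 K)"

end

theory Submission
  imports Defs
begin

text \<open>
  A triangle is encoded by its set \<open>V\<close> of three vertices, and the sides of \<open>V\<close> and their midpoints are
  read off from pairs of vertices.  One subdivision step replaces \<open>V\<close> by the six sets
  \<open>{v, midpoint v w, centroid V}\<close>, the centroids of the faces in a flag \<open>{v} \<subset> {v, w} \<subset> V\<close>.  Write
  \<open>C n\<close> for the family of vertex sets of level \<open>n\<close>.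

  Both circumference paths have the same shape.  Let \<open>P\<close> be the frontier of the triangle for \<open>Out\<close>,
  and the set containing just its barycenter for \<open>Inn\<close>.  The triangles in question are those with a
  vertex in \<open>P\<close>: for the frontier this is \<open>boundary_or_point_contact\<close>.  The graph that such triangles
  induce turns out to be a single cycle.  A cycle through all of them is therefore the whole induced
  graph, which gives existence and uniqueness at once (\<open>two_regular_connected_unique_cycle\<close>), and its
  length is the number of these triangles.

  That the induced graph is connected with two neighbours everywhere is carried through the
  subdivision as an invariant (\<open>collar\<close>) on the sides of the triangles: a side with exactly one
  endpoint in \<open>P\<close> lies in exactly two triangles, a side with both endpoints in \<open>P\<close> in one, and a side
  with no endpoint in \<open>P\<close> is never common to two triangles that touch \<open>P\<close>.  The step
  (\<open>refine_collar\<close>) needs that a midpoint lies in \<open>P\<close> exactly if both ends of its side do, and that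
  no centroid lies in \<open>P\<close> (\<open>marking\<close>).  For the frontier this follows from convexity and from the
  absence of chords, that is, of frontier vertices of one small triangle that lie on no common side of
  the large one; for the barycenter it holds because the barycenter is a vertex from level 1 on.

  That triangles from different parts of the subdivision meet only as they should is expressed by
  \<open>embedded\<close>: barycentric coordinates of a point are unique across the whole family.  Consequently
  different faces have different centroids, so that the sides that two refined triangles share can be
  computed from their flags.  Refinement preserves this property because the coordinates with respect
  to a flag are multiples of the differences of the sorted old coordinates (\<open>refine_embedded\<close>).

  For the lengths, let \<open>k V\<close> be the number of marked vertices of \<open>V\<close>, and put
  \<open>S n = (\<Sum>V\<in>C n. k V)\<close> and \<open>Q n = (\<Sum>V\<in>C n. k V * (k V - 1))\<close>.  A flag triangle touches \<open>P\<close> iff its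
  vertex \<open>v\<close> is marked, and it has a second marked vertex, the midpoint, iff \<open>w\<close> is marked too.  Hence
  \<open>2 * S n\<close> triangles of level \<open>n + 1\<close> touch \<open>P\<close>, \<open>S (n + 1) = 2 * S n + Q n\<close> and
  \<open>Q (n + 1) = 2 * Q n\<close>.  For the frontier, \<open>S 0 = 3\<close> and \<open>Q 0 = 6\<close> yield \<open>S n = 3 * (n + 1) * 2 ^ n\<close>;
  for the barycenter, \<open>S 1 = 6\<close> and \<open>Q 1 = 0\<close> yield \<open>S n = 3 * 2 ^ n\<close>, which there is also the number of
  touching triangles.
\<close>

section \<open>Embedded families of triangles\<close>

definition centroid :: "'a::real_vector set \<Rightarrow> 'a" where
  "centroid F = (1 / real (card F)) *\<^sub>R (\<Sum>p\<in>F. p)"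

definition flags :: "'a set set \<Rightarrow> ('a set \<times> 'a \<times> 'a) set" where
  "flags C = {(V, v, w). V \<in> C \<and> v \<in> V \<and> w \<in> V \<and> v \<noteq> w}"

definition flag_triangle :: "'a::real_vector set \<Rightarrow> 'a \<Rightarrow> 'a \<Rightarrow> 'a set" where
  "flag_triangle V v w = {v, midpoint v w, centroid V}"

definition refine :: "'a::real_vector set set \<Rightarrow> 'a set set" where
  "refine C = {flag_triangle V v w | V v w. (V, v, w) \<in> flags C}"

lemma refineE:
  assumes "c \<in> refine C"
  obtains V v w where "(V, v, w) \<in> flags C" "c = flag_triangle V v w"
  using assms unfolding refine_def by blast

lemma refineI: "(V, v, w) \<in> flags C \<Longrightarrow> flag_triangle V v w \<in> refine C"
  unfolding refine_def by blast

text \<open>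
  Coordinates are functions on the whole space that vanish off \<open>V\<close>, so that coordinates with respect
  to different vertex sets can be compared by plain equality.
\<close>

definition barycentric_coords :: "'a set \<Rightarrow> ('a \<Rightarrow> real) \<Rightarrow> bool" where
  "barycentric_coords V l \<longleftrightarrow> (\<forall>p. 0 \<le> l p) \<and> (\<forall>p. p \<notin> V \<longrightarrow> l p = 0) \<and> sum l V = 1"

text \<open>
  The family of vertex sets spans a geometric simplicial complex: a point is determined by, and
  determines, a formal convex combination of the vertices of some member.  Taking \<open>V = V'\<close> gives the
  affine independence of \<open>V\<close>, taking \<open>V \<noteq> V'\<close> says that two triangles meet in a common face.
\<close>

definition embedded :: "'a::real_vector set set \<Rightarrow> bool" where
  "embedded C \<longleftrightarrow> (\<forall>V\<in>C. card V = 3) \<and>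
     (\<forall>V\<in>C. \<forall>V'\<in>C. \<forall>l l'. barycentric_coords V l \<longrightarrow> barycentric_coords V' l' \<longrightarrow>
        (\<Sum>p\<in>V. l p *\<^sub>R p) = (\<Sum>p\<in>V'. l' p *\<^sub>R p) \<longrightarrow> l = l')"

lemma embedded_card: "embedded C \<Longrightarrow> V \<in> C \<Longrightarrow> card V = 3"
  by (simp add: embedded_def)

lemma embedded_finite: "embedded C \<Longrightarrow> V \<in> C \<Longrightarrow> finite V"
  by (metis card.infinite embedded_card zero_neq_numeral)

lemma embedded_unique:
  "embedded C \<Longrightarrow> V \<in> C \<Longrightarrow> V' \<in> C \<Longrightarrow> barycentric_coords V l \<Longrightarrow> barycentric_coords V' l' \<Longrightarrow>
   (\<Sum>p\<in>V. l p *\<^sub>R p) = (\<Sum>p\<in>V'. l' p *\<^sub>R p) \<Longrightarrow> l = l'"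
  unfolding embedded_def by blast

lemma embedded_singleton:
  assumes V: "\<not> affine_dependent V" "card V = 3"
  shows "embedded {V}"
proof -
  have fin: "finite V" using V(2) by (metis card.infinite zero_neq_numeral)
  have "l = l'" if l: "barycentric_coords V l" "barycentric_coords V l'"
    and eq: "(\<Sum>p\<in>V. l p *\<^sub>R p) = (\<Sum>p\<in>V. l' p *\<^sub>R p)" for l l'
  proof -
    have "sum (\<lambda>p. l p - l' p) V = 0" "(\<Sum>p\<in>V. (l p - l' p) *\<^sub>R p) = 0"
      using l eq by (simp_all add: barycentric_coords_def sum_subtractf scaleR_diff_left)
    then have "\<forall>p\<in>V. l p - l' p = 0"
      using V(1) unfolding affine_dependent_explicit_finite[OF fin] by metis
    then have "l p = l' p" for p
      using l by (cases "p \<in> V") (auto simp: barycentric_coords_def)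
    then show ?thesis by blast
  qed
  then show ?thesis using V(2) by (simp add: embedded_def)
qed

text \<open>
  Splitting an affine dependence into its positive and negative part gives, after scaling, two
  different convex combinations of \<open>V\<close> for the same point.
\<close>

lemma embedded_affine_independent:
  fixes C :: "'a::real_vector set set"
  assumes C: "embedded C" and V: "V \<in> C"
  shows "\<not> affine_dependent V"
proof
  assume "affine_dependent V"
  then obtain U v where U: "sum U V = 0" "v \<in> V" "U v \<noteq> 0" "(\<Sum>p\<in>V. U p *\<^sub>R p) = 0"
    using affine_dependent_explicit_finite[OF embedded_finite[OF C V]] by auto
  have fin: "finite V" using embedded_finite[OF C V] .
  \<comment> \<open>the common mass of the positive and the negative part of \<open>U\<close>\<close>
  define S where "S = (\<Sum>p\<in>V. max (U p) 0)"
  have split: "max (U p) 0 - max (- U p) 0 = U p" for p by (auto simp: max_def)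
  have "(\<Sum>p\<in>V. max (U p) 0) - (\<Sum>p\<in>V. max (- U p) 0) = 0"
    using U(1) split by (simp add: sum_subtractf[symmetric])
  then have S': "S = (\<Sum>p\<in>V. max (- U p) 0)" by (simp add: S_def)
  have nn: "0 \<le> S" by (simp add: S_def sum_nonneg)
  have "S \<noteq> 0"
  proof
    assume "S = 0"
    then have "max (U v) 0 = 0" "max (- U v) 0 = 0"
      using S' fin U(2) by (simp_all add: S_def sum_nonneg_eq_0_iff)
    then show False using U(3) by (auto simp: max_def split: if_splits)
  qed
  with nn have Spos: "0 < S" by simp
  define l where "l = (\<lambda>p. if p \<in> V then max (U p) 0 / S else 0)"
  define l' where "l' = (\<lambda>p. if p \<in> V then max (- U p) 0 / S else 0)"
  have "barycentric_coords V l"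
    using Spos by (simp add: barycentric_coords_def l_def S_def[symmetric] sum_divide_distrib[symmetric])
  moreover have "barycentric_coords V l'"
    using Spos by (simp add: barycentric_coords_def l'_def S'[symmetric] sum_divide_distrib[symmetric])
  moreover have "(\<Sum>p\<in>V. l p *\<^sub>R p) - (\<Sum>p\<in>V. l' p *\<^sub>R p) = (1 / S) *\<^sub>R (\<Sum>p\<in>V. U p *\<^sub>R p)"
    unfolding sum_subtractf[symmetric] scaleR_sum_right
  proof (intro sum.cong refl)
    fix p
    assume "p \<in> V"
    then have "l p - l' p = U p / S" using split[of p] by (simp add: l_def l'_def diff_divide_distrib[symmetric])
    then show "l p *\<^sub>R p - l' p *\<^sub>R p = (1 / S) *\<^sub>R U p *\<^sub>R p"
      by (simp add: scaleR_diff_left[symmetric])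
  qed
  ultimately have "l = l'"
    using embedded_unique[OF C V V, of l l'] U(4) by simp
  then have "l v = l' v" by simp
  then have "max (U v) 0 = max (- U v) 0"
    using U(2) Spos by (simp add: l_def l'_def)
  then show False using U(3) by (auto simp: max_def split: if_splits)
qed

text \<open>
  The centroid of a face has the coordinates that are constant on the face and zero elsewhere; the
  face is the support of its coordinates, whence \<open>centroid_inject\<close>.
\<close>

lemma centroid_coords:
  assumes "finite V" "F \<subseteq> V" "F \<noteq> {}"
  shows "barycentric_coords V (\<lambda>p. if p \<in> F then 1 / real (card F) else 0)"
    and "(\<Sum>p\<in>V. (if p \<in> F then 1 / real (card F) else 0) *\<^sub>R p) = centroid F"
proof -
  have VF: "V \<inter> F = F" and fin: "finite F"
    using assms by (auto intro: finite_subset)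
  show "barycentric_coords V (\<lambda>p. if p \<in> F then 1 / real (card F) else 0)"
    using assms fin VF by (auto simp: barycentric_coords_def sum.If_cases)
  have "(\<Sum>p\<in>V. (if p \<in> F then 1 / real (card F) else 0) *\<^sub>R p) =
      (\<Sum>p\<in>V. if p \<in> F then (1 / real (card F)) *\<^sub>R p else 0)"
    by (intro sum.cong) auto
  then show "(\<Sum>p\<in>V. (if p \<in> F then 1 / real (card F) else 0) *\<^sub>R p) = centroid F"
    using assms VF by (simp add: centroid_def sum.If_cases scaleR_sum_right)
qed

lemma centroid_inject:
  assumes "embedded C" "V \<in> C" "V' \<in> C" "F \<subseteq> V" "F' \<subseteq> V'" "F \<noteq> {}" "F' \<noteq> {}"
    and "centroid F = centroid F'"
  shows "F = F'"
proof -
  let ?l = "\<lambda>F p. if p \<in> F then 1 / real (card F) else 0"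
  have fin: "finite V" "finite V'"
    using assms embedded_finite by blast+
  then have finF: "finite F" "finite F'"
    using assms finite_subset by blast+
  have "?l F = ?l F'"
    using assms fin
    by (intro embedded_unique[OF assms(1-3)] centroid_coords) (simp_all add: centroid_coords)
  then have "p \<in> F \<longleftrightarrow> p \<in> F'" for p
    using fun_cong[of "?l F" "?l F'" p] finF assms by (auto split: if_splits)
  then show ?thesis by blast
qed

lemma centroid_singleton [simp]: "centroid {v} = v"
  by (simp add: centroid_def)

lemma centroid_pair: "v \<noteq> w \<Longrightarrow> centroid {v, w} = midpoint v w"
  by (simp add: centroid_def midpoint_def inverse_eq_divide)

text \<open>
  A refined triangle consists of three centroids of faces, so injectivity of \<open>centroid\<close> reduces
  membership in it to an equality of faces.  Everything below about shared vertices of refined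
  triangles rests on these three equivalences.
\<close>

lemma flag_face_iff:
  assumes "embedded C" "(V, v, w) \<in> flags C" "(V', v', w') \<in> flags C"
  shows mem_flag_vertex: "v \<in> flag_triangle V' v' w' \<longleftrightarrow> v = v'"
    and mem_flag_midpoint: "midpoint v w \<in> flag_triangle V' v' w' \<longleftrightarrow> {v, w} = {v', w'}"
    and mem_flag_centroid: "centroid V \<in> flag_triangle V' v' w' \<longleftrightarrow> V = V'"
proof -
  have f: "V \<in> C" "v \<in> V" "w \<in> V" "v \<noteq> w" "V' \<in> C" "v' \<in> V'" "w' \<in> V'" "v' \<noteq> w'"
    using assms by (auto simp: flags_def)
  have c: "card V = 3" "card V' = 3"
    using embedded_card[OF assms(1)] f by auto
  have inj: "centroid F = centroid F' \<longleftrightarrow> F = F'" if "F \<subseteq> V" "F' \<subseteq> V'" "F \<noteq> {}" "F' \<noteq> {}" for F F'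
    using centroid_inject[OF assms(1) f(1) f(5) that] by blast
  have e: "flag_triangle V' v' w' = {centroid {v'}, centroid {v', w'}, centroid V'}"
    using f by (simp add: flag_triangle_def centroid_pair)
  have n: "V \<noteq> {v'}" "V \<noteq> {v', w'}" "V' \<noteq> {v}" "V' \<noteq> {v, w}"
    using c f by auto
  have "centroid {v} \<in> flag_triangle V' v' w' \<longleftrightarrow> v = v'"
    unfolding e using f n inj[of "{v}" "{v'}"] inj[of "{v}" "{v', w'}"] inj[of "{v}" V'] by auto
  then show "v \<in> flag_triangle V' v' w' \<longleftrightarrow> v = v'" by simp
  have "centroid {v, w} = centroid {v', w'} \<longleftrightarrow> {v, w} = {v', w'}"
    using f by (intro inj) auto
  moreover have "centroid {v, w} \<noteq> centroid {v'}"
    using f inj[of "{v, w}" "{v'}"] by auto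
  moreover have "centroid {v, w} \<noteq> centroid V'"
    using f n(4) inj[of "{v, w}" V'] by auto
  ultimately have "centroid {v, w} \<in> flag_triangle V' v' w' \<longleftrightarrow> {v, w} = {v', w'}"
    unfolding e by blast
  then show "midpoint v w \<in> flag_triangle V' v' w' \<longleftrightarrow> {v, w} = {v', w'}"
    using f by (simp add: centroid_pair)
  have "centroid V = centroid V' \<longleftrightarrow> V = V'"
    using f by (intro inj) auto
  moreover have "centroid V \<noteq> centroid {v'}"
    using f n(1) inj[of V "{v'}"] by auto
  moreover have "centroid V \<noteq> centroid {v', w'}"
    using f n(2) inj[of V "{v', w'}"] by auto
  ultimately show "centroid V \<in> flag_triangle V' v' w' \<longleftrightarrow> V = V'"
    unfolding e by blast
qed

lemma flag_distinct:
  assumes "embedded C" "(V, v, w) \<in> flags C"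
  shows "v \<noteq> midpoint v w" "v \<noteq> centroid V" "midpoint v w \<noteq> centroid V"
proof -
  have f: "V \<in> C" "v \<in> V" "w \<in> V" "v \<noteq> w" and c: "card V = 3"
    using assms embedded_card by (auto simp: flags_def)
  have inj: "centroid F \<noteq> centroid F'"
    if "F \<subseteq> V" "F' \<subseteq> V" "F \<noteq> {}" "F' \<noteq> {}" "F \<noteq> F'" for F F'
    using centroid_inject[OF assms(1) f(1) f(1)] that by blast
  have "V \<noteq> {v}" "V \<noteq> {v, w}"
    using c f by auto
  with f inj[of "{v}" "{v, w}"] inj[of "{v}" V] inj[of "{v, w}" V]
  show "v \<noteq> midpoint v w" "v \<noteq> centroid V" "midpoint v w \<noteq> centroid V"
    by (auto simp: centroid_pair)
qed

lemma flag_triangle_inject: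
  assumes "embedded C" "(V, v, w) \<in> flags C" "(V', v', w') \<in> flags C"
    and eq: "flag_triangle V v w = flag_triangle V' v' w'"
  shows "V = V'" "v = v'" "w = w'"
proof -
  have "v \<in> flag_triangle V' v' w'" "midpoint v w \<in> flag_triangle V' v' w'"
    "centroid V \<in> flag_triangle V' v' w'"
    using eq by (auto simp: flag_triangle_def)
  then have "v = v'" "{v, w} = {v', w'}" "V = V'"
    using flag_face_iff[OF assms(1-3)] by auto
  then show "V = V'" "v = v'" "w = w'"
    by (auto simp: doubleton_eq_iff)
qed

lemma flag_third_vertex:
  assumes "embedded C" "(V, v, w) \<in> flags C"
  obtains u where "V = {v, w, u}" "u \<noteq> v" "u \<noteq> w"
proof -
  have f: "V \<in> C" "v \<in> V" "w \<in> V" "v \<noteq> w" and c: "card V = 3"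
    using assms embedded_card by (auto simp: flags_def)
  have fin: "finite V" using c by (metis card.infinite zero_neq_numeral)
  have "card (V - {v, w}) = 1"
    using f c fin by (simp add: card_Diff_subset)
  then obtain u where "V - {v, w} = {u}" by (rule card_1_singletonE)
  then show thesis using f that[of u] by blast
qed

section \<open>Refinement preserves embeddedness\<close>

text \<open>
  If \<open>l\<close> is a combination of \<open>v\<close>, the midpoint of \<open>v\<close> and \<open>w\<close>, and the centroid, then the old vertices
  receive \<open>k v = l v + l m / 2 + l b / 3\<close>, \<open>k w = l m / 2 + l b / 3\<close> and \<open>k u = l b / 3\<close>.  These are
  sorted, and \<open>l\<close> is recovered from their successive differences.
\<close>

lemma refine_coords:
  assumes "embedded C" "(V, v, w) \<in> flags C" "V = {v, w, u}" "u \<noteq> v" "u \<noteq> w"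
    and l: "barycentric_coords (flag_triangle V v w) l"
  obtains k where "barycentric_coords V k" "k u \<le> k w" "k w \<le> k v"
    "l v = k v - k w" "l (midpoint v w) = 2 * (k w - k u)" "l (centroid V) = 3 * k u"
    "(\<Sum>p\<in>V. k p *\<^sub>R p) = (\<Sum>p\<in>flag_triangle V v w. l p *\<^sub>R p)"
proof -
  have vw: "v \<noteq> w" using assms(2) by (simp add: flags_def)
  note d = flag_distinct[OF assms(1,2)]
  define m b where "m = midpoint v w" and "b = centroid V"
  define k where "k = (\<lambda>p. if p = v then l v + l m / 2 + l b / 3
      else if p = w then l m / 2 + l b / 3 else if p = u then l b / 3 else 0)"
  have kv: "k v = l v + l m / 2 + l b / 3" "k w = l m / 2 + l b / 3" "k u = l b / 3"
    using vw assms(4,5) by (auto simp: k_def)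
  have nn: "0 \<le> l p" for p
    using l by (simp add: barycentric_coords_def)
  have s1: "l v + l m + l b = 1"
    using l d by (simp add: barycentric_coords_def flag_triangle_def m_def b_def)
  have b: "b = (1/3) *\<^sub>R (v + w + u)"
    using vw assms(3-5) by (simp add: b_def centroid_def algebra_simps)
  have m: "m = (1/2) *\<^sub>R (v + w)"
    by (simp add: m_def midpoint_def inverse_eq_divide)
  have "barycentric_coords V k"
    unfolding barycentric_coords_def
  proof (intro conjI allI impI)
    show "0 \<le> k p" for p using nn by (simp add: k_def)
    show "k p = 0" if "p \<notin> V" for p using that assms(3) by (simp add: k_def)
    have "sum k V = k v + k w + k u" using vw assms(3-5) by simp
    then show "sum k V = 1" using s1 kv by simp
  qed
  moreover have "(\<Sum>p\<in>V. k p *\<^sub>R p) = (\<Sum>p\<in>flag_triangle V v w. l p *\<^sub>R p)"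
  proof -
    have "(\<Sum>p\<in>V. k p *\<^sub>R p) = k v *\<^sub>R v + k w *\<^sub>R w + k u *\<^sub>R u"
      using vw assms(3-5) by simp
    also have "\<dots> = l v *\<^sub>R v + l m *\<^sub>R m + l b *\<^sub>R b"
      unfolding kv b m by (simp add: algebra_simps)
    also have "\<dots> = (\<Sum>p\<in>flag_triangle V v w. l p *\<^sub>R p)"
      using d by (simp add: flag_triangle_def m_def b_def)
    finally show ?thesis .
  qed
  moreover have "k u \<le> k w" "k w \<le> k v"
    using kv nn[of v] nn[of m] by auto
  moreover have "l v = k v - k w" "l (midpoint v w) = 2 * (k w - k u)" "l (centroid V) = 3 * k u"
    using kv by (simp_all add: m_def b_def)
  ultimately show thesis by (intro that)
qed

text \<open>
  A strict descent in a sorted list of coordinates is visible without knowing the list: if \<open>k w < k v\<close>,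
  then \<open>v\<close> is the only point where \<open>k\<close> is maximal, so every other sorted list starts with \<open>v\<close> too;
  if \<open>k u < k w\<close>, then the two largest values sit at \<open>v\<close> and \<open>w\<close>; and if \<open>k u\<close> is positive, then the
  support of \<open>k\<close> is all of \<open>V\<close>.  In each case the points of \<open>V'\<close> that follow have values at most as
  large as the corresponding ones in \<open>V\<close>, so the descent in \<open>V'\<close> is at least the one in \<open>V\<close>.
\<close>

lemma sorted_coords_le:
  assumes V: "V = {v, w, u}" "v \<noteq> w" "u \<noteq> v" "u \<noteq> w"
    and V': "V' = {v', w', u'}" "v' \<noteq> w'" "u' \<noteq> v'" "u' \<noteq> w'"
    and k: "barycentric_coords V k" "barycentric_coords V' k"
    and s: "k u \<le> k w" "k w \<le> k v" "k u' \<le> k w'" "k w' \<le> k v'"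
  shows "k w < k v \<Longrightarrow> v = v' \<and> k v - k w \<le> k v' - k w'"
    and "k u < k w \<Longrightarrow> {v, w} = {v', w'} \<and> k w - k u \<le> k w' - k u'"
    and "0 < k u \<Longrightarrow> V = V' \<and> k u \<le> k u'"
proof -
  have z: "k p = 0" if "p \<notin> V \<or> p \<notin> V'" for p
    using k that by (auto simp: barycentric_coords_def)
  have nn: "0 \<le> k p" for p
    using k by (simp add: barycentric_coords_def)
  have a: "p = v \<or> p = w \<or> p = u \<or> k p = 0" "p = v' \<or> p = w' \<or> p = u' \<or> k p = 0" for p
    using z[of p] V V' by auto
  have vv': "k v \<le> k v'"
    using a(2)[of v] s nn[of v'] by auto
  show "v = v' \<and> k v - k w \<le> k v' - k w'" if "k w < k v"
  proof -
    have "v' = v"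
      using a(1)[of v'] vv' that s nn[of w] by auto
    moreover have "k w' \<le> k w"
      using a(1)[of w'] calculation V'(2) s nn[of w] by auto
    ultimately show ?thesis by simp
  qed
  show "{v, w} = {v', w'} \<and> k w - k u \<le> k w' - k u'" if "k u < k w"
  proof -
    have "v' = v \<or> v' = w"
      using a(1)[of v'] vv' that s nn[of u] by auto
    moreover have "k w \<le> k w'"
      using a(2)[of v] a(2)[of w] V(2) s nn[of w'] by auto
    then have "w' = v \<or> w' = w"
      using a(1)[of w'] that s nn[of u] by auto
    ultimately have eq: "{v, w} = {v', w'}"
      using V'(2) by auto
    moreover have "u' \<noteq> v" "u' \<noteq> w"
      using eq V'(3,4) by auto
    then have "k u' \<le> k u"
      using a(1)[of u'] nn[of u] by auto
    ultimately show ?thesis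
      using \<open>k w \<le> k w'\<close> by simp
  qed
  show "V = V' \<and> k u \<le> k u'" if "0 < k u"
  proof -
    have "V \<subseteq> V'"
    proof
      fix p
      assume "p \<in> V"
      then have "0 < k p" using V(1) s that by auto
      then show "p \<in> V'" using z[of p] by auto
    qed
    moreover have "card V = 3" "card V' = 3" using V V' by auto
    ultimately have "V = V'"
      by (metis card.infinite card_subset_eq zero_neq_numeral)
    then have "u' \<in> V" using V' by simp
    then show ?thesis using \<open>V = V'\<close> V s by auto
  qed
qed

text \<open>
  Two sets of new coordinates for a point induce the same old coordinates.  Wherever the first set is
  positive, \<open>sorted_coords_le\<close> identifies the corresponding face in both flags and compares the
  coefficients; by symmetry the two sets agree.
\<close>

lemma refine_embedded:
  assumes C: "embedded C"
  shows "embedded (refine C)"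
proof -
  have le: "l p \<le> l' p"
    if f: "(V, v, w) \<in> flags C" "(V', v', w') \<in> flags C"
      and l: "barycentric_coords (flag_triangle V v w) l"
        "barycentric_coords (flag_triangle V' v' w') l'"
      and eq: "(\<Sum>p\<in>flag_triangle V v w. l p *\<^sub>R p) = (\<Sum>p\<in>flag_triangle V' v' w'. l' p *\<^sub>R p)"
    for V v w V' v' w' l l' p
  proof -
    obtain u where u: "V = {v, w, u}" "u \<noteq> v" "u \<noteq> w"
      using flag_third_vertex[OF C f(1)] .
    obtain u' where u': "V' = {v', w', u'}" "u' \<noteq> v'" "u' \<noteq> w'"
      using flag_third_vertex[OF C f(2)] .
    obtain k where k: "barycentric_coords V k" "k u \<le> k w" "k w \<le> k v"
      "l v = k v - k w" "l (midpoint v w) = 2 * (k w - k u)" "l (centroid V) = 3 * k u"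
      "(\<Sum>p\<in>V. k p *\<^sub>R p) = (\<Sum>p\<in>flag_triangle V v w. l p *\<^sub>R p)"
      using refine_coords[OF C f(1) u l(1)] .
    obtain k' where k': "barycentric_coords V' k'" "k' u' \<le> k' w'" "k' w' \<le> k' v'"
      "l' v' = k' v' - k' w'" "l' (midpoint v' w') = 2 * (k' w' - k' u')"
      "l' (centroid V') = 3 * k' u'"
      "(\<Sum>p\<in>V'. k' p *\<^sub>R p) = (\<Sum>p\<in>flag_triangle V' v' w'. l' p *\<^sub>R p)"
      using refine_coords[OF C f(2) u' l(2)] .
    have VC: "V \<in> C" "V' \<in> C" "v \<noteq> w" "v' \<noteq> w'"
      using f by (auto simp: flags_def)
    have "k = k'"
      using embedded_unique[OF C VC(1,2) k(1) k'(1)] k(7) k'(7) eq by simp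
    note s = sorted_coords_le[OF u(1) VC(3) u(2,3) u'(1) VC(4) u'(2,3) k(1) _ k(2,3)]
    note s = s[unfolded \<open>k = k'\<close>, OF k'(1-3)]
    have nn: "0 \<le> l' p" using l by (simp add: barycentric_coords_def)
    show ?thesis
    proof (cases "0 < l p")
      case False
      then show ?thesis using nn by simp
    next
      case True
      then have "p = v \<or> p = midpoint v w \<or> p = centroid V"
        using l(1) by (auto simp: barycentric_coords_def flag_triangle_def)
      then show ?thesis
      proof (elim disjE)
        assume "p = v"
        then show ?thesis using s(1) k(4) k'(4) True \<open>k = k'\<close> by auto
      next
        assume p: "p = midpoint v w"
        then have "{v, w} = {v', w'} \<and> k w - k u \<le> k w' - k u'"
          using s(2) k(5) True \<open>k = k'\<close> by simp
        moreover from this have "midpoint v w = midpoint v' w'"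
          by (auto simp: doubleton_eq_iff midpoint_sym)
        ultimately show ?thesis using p k(5) k'(5) \<open>k = k'\<close> by simp
      next
        assume "p = centroid V"
        then show ?thesis using s(3) k(6) k'(6) True \<open>k = k'\<close> by auto
      qed
    qed
  qed
  have "card c = 3" if "c \<in> refine C" for c
  proof -
    obtain V v w where "(V, v, w) \<in> flags C" "c = flag_triangle V v w"
      using \<open>c \<in> refine C\<close> by (rule refineE)
    then show ?thesis
      using flag_distinct[OF C, of V v w] by (simp add: flag_triangle_def)
  qed
  moreover have "l = l'"
    if c: "c \<in> refine C" "c' \<in> refine C" and l: "barycentric_coords c l" "barycentric_coords c' l'"
      and eq: "(\<Sum>p\<in>c. l p *\<^sub>R p) = (\<Sum>p\<in>c'. l' p *\<^sub>R p)" for c c' l l'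
  proof -
    obtain V v w V' v' w' where f: "(V, v, w) \<in> flags C" "(V', v', w') \<in> flags C"
      and e: "c = flag_triangle V v w" "c' = flag_triangle V' v' w'"
      using c by (meson refineE)
    show ?thesis
      using le[OF f l[unfolded e] eq[unfolded e]]
        le[OF f(2) f(1) l(2)[unfolded e] l(1)[unfolded e] eq[unfolded e, symmetric]]
      by (intro ext antisym)
  qed
  ultimately show ?thesis unfolding embedded_def by blast
qed

lemma finite_refine:
  assumes C: "embedded C" and fin: "finite C"
  shows "finite (refine C)"
proof -
  have "flags C \<subseteq> C \<times> \<Union>C \<times> \<Union>C" by (auto simp: flags_def)
  moreover have "finite (\<Union>C)" using fin embedded_finite[OF C] by blast
  ultimately have "finite (flags C)"
    using fin by (meson finite_SigmaI finite_subset)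
  moreover have "refine C = (\<lambda>(V, v, w). flag_triangle V v w) ` flags C"
    by (force simp: refine_def)
  ultimately show ?thesis by simp
qed

lemma iterated_refine:
  assumes "embedded {V\<^sub>0}"
  shows "embedded ((refine ^^ n) {V\<^sub>0}) \<and> finite ((refine ^^ n) {V\<^sub>0})"
  by (induction n) (simp_all add: assms refine_embedded finite_refine)

section \<open>Triangles touching a marked set\<close>

definition share_side :: "'a set \<Rightarrow> 'a set \<Rightarrow> bool" where
  "share_side V V' \<longleftrightarrow> (\<exists>x y. x \<noteq> y \<and> {x, y} \<subseteq> V \<inter> V')"

definition touching :: "'a set set \<Rightarrow> 'a set \<Rightarrow> 'a set set" where
  "touching C P = {V \<in> C. V \<inter> P \<noteq> {}}"

text \<open>
  A triangle shares a side with itself in this sense.  That is harmless, since only the reflexive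
  transitive closure of the relation is used.
\<close>

definition touching_step :: "'a set set \<Rightarrow> 'a set \<Rightarrow> 'a set \<Rightarrow> 'a set \<Rightarrow> bool" where
  "touching_step C P V V' \<longleftrightarrow> V \<in> touching C P \<and> V' \<in> touching C P \<and> share_side V V'"

text \<open>
  The marked set does not see the new vertices beyond what the old ones dictate: this is what makes
  the number of marked vertices of a refined triangle depend on its flag only.
\<close>

definition marking :: "'a::real_vector set set \<Rightarrow> 'a set \<Rightarrow> bool" where
  "marking C P \<longleftrightarrow> (\<forall>V\<in>C. centroid V \<notin> P \<and>
     (\<forall>x\<in>V. \<forall>y\<in>V. x \<noteq> y \<longrightarrow> (midpoint x y \<in> P \<longleftrightarrow> x \<in> P \<and> y \<in> P)))"

text \<open>
  The triangles that touch \<open>P\<close> form a thin closed strip along \<open>P\<close>.  The four clauses concern sides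
  crossing the strip (one marked endpoint), sides inside \<open>P\<close>, sides on the far rim of the strip (no
  marked endpoint), and connectedness.  In the first clause, \<open>V'\<close> is the neighbour of \<open>V\<close> across the
  side.
\<close>

definition collar :: "'a set set \<Rightarrow> 'a set \<Rightarrow> bool" where
  "collar C P \<longleftrightarrow>
     (\<forall>V\<in>C. \<forall>x\<in>V \<inter> P. \<forall>y\<in>V - P. \<exists>!V'. V' \<in> C \<and> V' \<noteq> V \<and> {x, y} \<subseteq> V') \<and>
     (\<forall>V\<in>C. \<forall>V'\<in>C. \<forall>x\<in>P. \<forall>y\<in>P. x \<noteq> y \<and> {x, y} \<subseteq> V \<inter> V' \<longrightarrow> V = V') \<and>
     (\<forall>V\<in>touching C P. \<forall>V'\<in>touching C P. \<forall>x y. x \<notin> P \<and> y \<notin> P \<and> x \<noteq> y \<and>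
        {x, y} \<subseteq> V \<inter> V' \<longrightarrow> V = V') \<and>
     (\<forall>V\<in>touching C P. \<forall>V'\<in>touching C P. (touching_step C P)\<^sup>*\<^sup>* V V')"

lemma collarD:
  assumes "collar C P"
  shows collar_half: "V \<in> C \<Longrightarrow> {x, y} \<subseteq> V \<Longrightarrow> x \<in> P \<Longrightarrow> y \<notin> P \<Longrightarrow>
      \<exists>!V'. V' \<in> C \<and> V' \<noteq> V \<and> {x, y} \<subseteq> V'"
    and collar_inside: "V \<in> C \<Longrightarrow> V' \<in> C \<Longrightarrow> {x, y} \<subseteq> V \<inter> V' \<Longrightarrow> x \<in> P \<Longrightarrow> y \<in> P \<Longrightarrow> x \<noteq> y \<Longrightarrow> V = V'"
    and collar_outside: "V \<in> touching C P \<Longrightarrow> V' \<in> touching C P \<Longrightarrow> {x, y} \<subseteq> V \<inter> V' \<Longrightarrow>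
      x \<notin> P \<Longrightarrow> y \<notin> P \<Longrightarrow> x \<noteq> y \<Longrightarrow> V = V'"
    and collar_connected: "V \<in> touching C P \<Longrightarrow> V' \<in> touching C P \<Longrightarrow> (touching_step C P)\<^sup>*\<^sup>* V V'"
proof -
  note c = assms[unfolded collar_def]
  show "\<exists>!V'. V' \<in> C \<and> V' \<noteq> V \<and> {x, y} \<subseteq> V'"
    if "V \<in> C" "{x, y} \<subseteq> V" "x \<in> P" "y \<notin> P"
    by (rule c[THEN conjunct1, rule_format]) (use that in auto)
  show "V = V'" if "V \<in> C" "V' \<in> C" "{x, y} \<subseteq> V \<inter> V'" "x \<in> P" "y \<in> P" "x \<noteq> y"
    by (rule c[THEN conjunct2, THEN conjunct1, rule_format]) (use that in auto)
  show "V = V'" if "V \<in> touching C P" "V' \<in> touching C P" "{x, y} \<subseteq> V \<inter> V'"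
    "x \<notin> P" "y \<notin> P" "x \<noteq> y"
    by (rule c[THEN conjunct2, THEN conjunct2, THEN conjunct1, rule_format]) (use that in auto)
  show "(touching_step C P)\<^sup>*\<^sup>* V V'" if "V \<in> touching C P" "V' \<in> touching C P"
    by (rule c[THEN conjunct2, THEN conjunct2, THEN conjunct2, rule_format]) (use that in auto)
qed

lemma flag_triangle_marks:
  assumes "marking C P" "(V, v, w) \<in> flags C"
  shows "centroid V \<notin> P" "midpoint v w \<in> P \<longleftrightarrow> v \<in> P \<and> w \<in> P"
  using assms by (auto simp: marking_def flags_def)

lemma flag_triangle_touching:
  assumes "marking C P" "(V, v, w) \<in> flags C"
  shows "flag_triangle V v w \<in> touching (refine C) P \<longleftrightarrow> v \<in> P"
  using flag_triangle_marks[OF assms] refineI[OF assms(2)]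
  by (auto simp: touching_def flag_triangle_def)

lemma refine_proper: "marking C P \<Longrightarrow> c \<in> refine C \<Longrightarrow> \<not> c \<subseteq> P"
  using flag_triangle_marks(1) by (force simp: flag_triangle_def elim!: refineE)

lemma flags_swap: "(V, v, w) \<in> flags C \<Longrightarrow> (V, w, v) \<in> flags C"
  by (auto simp: flags_def)

text \<open>
  The touching children of one triangle are linked to each other: those at the same vertex share the
  segment from that vertex to the centroid, and those at different ends of one side share the segment
  from the midpoint to the centroid.  If two different touching triangles share a side, then it has a marked end
  \<open>p\<close>, and their children at \<open>p\<close> along that side share its half.
\<close>

lemma refine_touching_connected:
  assumes C: "embedded C" and P: "marking C P" and col: "collar C P"
    and t: "c \<in> touching (refine C) P" "c' \<in> touching (refine C) P"
  shows "(touching_step (refine C) P)\<^sup>*\<^sup>* c c'"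
proof -
  let ?S = "touching_step (refine C) P"
  have child_step: "?S (flag_triangle V v w) (flag_triangle V' v' w')"
    if "(V, v, w) \<in> flags C" "(V', v', w') \<in> flags C" "v \<in> P" "v' \<in> P"
      "V = V' \<and> (v = v' \<or> {v, w} = {v', w'}) \<or> v = v' \<and> w = w'"
    for V v w V' v' w'
  proof -
    have d: "v \<noteq> centroid V" "midpoint v w \<noteq> centroid V" "v \<noteq> midpoint v w"
      using flag_distinct[OF C that(1)] by auto
    have "\<exists>x y. x \<noteq> y \<and> {x, y} \<subseteq> flag_triangle V v w \<inter> flag_triangle V' v' w'"
      using that(5)
    proof (elim disjE conjE)
      assume "V = V'" "v = v'"
      with d(1) show ?thesis by (intro exI[of _ v] exI[of _ "centroid V"]) (simp add: flag_triangle_def)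
    next
      assume "V = V'" "{v, w} = {v', w'}"
      moreover from this have "midpoint v w = midpoint v' w'"
        by (auto simp: doubleton_eq_iff midpoint_sym)
      ultimately show ?thesis using d(2)
        by (intro exI[of _ "midpoint v w"] exI[of _ "centroid V"]) (simp add: flag_triangle_def)
    next
      assume "v = v'" "w = w'"
      with d(3) show ?thesis
        by (intro exI[of _ v] exI[of _ "midpoint v w"]) (simp add: flag_triangle_def)
    qed
    then show ?thesis
      using flag_triangle_touching[OF P] that(1-4) by (simp add: touching_step_def share_side_def)
  qed
  have same: "?S\<^sup>*\<^sup>* (flag_triangle V v w) (flag_triangle V v' w')"
    if f: "(V, v, w) \<in> flags C" "(V, v', w') \<in> flags C" and vP: "v \<in> P" "v' \<in> P" for V v w v' w'
  proof (cases "v = v'")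
    case True
    then show ?thesis using child_step[OF f vP] by blast
  next
    case False
    then have g: "(V, v, v') \<in> flags C" "(V, v', v) \<in> flags C"
      using f by (auto simp: flags_def)
    have "?S (flag_triangle V v w) (flag_triangle V v v')"
      using child_step[OF f(1) g(1)] vP by simp
    moreover have "?S (flag_triangle V v v') (flag_triangle V v' v)"
      using child_step[OF g] vP by (simp add: insert_commute)
    moreover have "?S (flag_triangle V v' v) (flag_triangle V v' w')"
      using child_step[OF g(2) f(2)] vP by simp
    ultimately show ?thesis
      by (meson converse_rtranclp_into_rtranclp r_into_rtranclp)
  qed
  have chain: "\<forall>v w v' w'. (V, v, w) \<in> flags C \<longrightarrow> (V', v', w') \<in> flags C \<longrightarrow> v \<in> P \<longrightarrow> v' \<in> P \<longrightarrow>
      ?S\<^sup>*\<^sup>* (flag_triangle V v w) (flag_triangle V' v' w')"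
    if "(touching_step C P)\<^sup>*\<^sup>* V V'" for V V'
    using that
  proof (induction rule: rtranclp_induct)
    case base
    then show ?case using same by blast
  next
    case (step V1 V2)
    note touch = step.hyps(2)[unfolded touching_step_def]
    then obtain x y where xy: "x \<noteq> y" "{x, y} \<subseteq> V1 \<inter> V2"
      by (auto simp: share_side_def)
    have VC: "V1 \<in> C" "V2 \<in> C" using touch by (auto simp: touching_def)
    show ?case
    proof (cases "V1 = V2")
      case True
      then show ?thesis using step.IH by simp
    next
      case False
      then have "x \<in> P \<or> y \<in> P"
        using collar_outside[OF col, of V1 V2 x y] touch xy by auto
      then obtain p q where pq: "p \<in> P" "p \<noteq> q" "{p, q} \<subseteq> V1 \<inter> V2"
        using xy by (metis insert_commute)
      have g: "(V1, p, q) \<in> flags C" "(V2, p, q) \<in> flags C"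
        using pq VC by (auto simp: flags_def)
      show ?thesis
      proof (intro allI impI)
        fix v w v' w'
        assume f: "(V, v, w) \<in> flags C" "(V2, v', w') \<in> flags C" "v \<in> P" "v' \<in> P"
        have "?S\<^sup>*\<^sup>* (flag_triangle V v w) (flag_triangle V1 p q)"
          using step.IH f g pq by blast
        also have "?S (flag_triangle V1 p q) (flag_triangle V2 p q)"
          using child_step[OF g] pq(1) by simp
        also have "?S\<^sup>*\<^sup>* (flag_triangle V2 p q) (flag_triangle V2 v' w')"
          using same g f pq by blast
        finally show "?S\<^sup>*\<^sup>* (flag_triangle V v w) (flag_triangle V2 v' w')" .
      qed
    qed
  qed
  have cr: "c \<in> refine C" "c' \<in> refine C" using t by (auto simp: touching_def)
  obtain V v w where f: "(V, v, w) \<in> flags C" "c = flag_triangle V v w"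
    using cr(1) by (rule refineE)
  obtain V' v' w' where f': "(V', v', w') \<in> flags C" "c' = flag_triangle V' v' w'"
    using cr(2) by (rule refineE)
  have vP: "v \<in> P" "v' \<in> P"
    using flag_triangle_touching[OF P] f f' t by auto
  then have "V \<in> touching C P" "V' \<in> touching C P"
    using f f' by (auto simp: flags_def touching_def)
  then show ?thesis
    using chain collar_connected[OF col] f f' vP by blast
qed

text \<open>
  A side of a flag triangle is one of three kinds.  The ones ending in the centroid of \<open>V\<close> are common
  only to children of \<open>V\<close>, which settles them by inspection.  The remaining one, from \<open>v\<close> to the
  midpoint of \<open>v\<close> and \<open>w\<close>, lies on the old side with ends \<open>v\<close> and \<open>w\<close>; if \<open>v\<close> is marked, its triangles
  correspond to the old triangles at that side, and the invariant for the old side applies.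
\<close>

lemma refine_collar:
  assumes C: "embedded C" and P: "marking C P" and col: "collar C P"
  shows "collar (refine C) P"
proof -
  have half: "\<exists>!c'. c' \<in> refine C \<and> c' \<noteq> c \<and> {x, y} \<subseteq> c'"
    if c: "c \<in> refine C" and x: "x \<in> c" "x \<in> P" and y: "y \<in> c" "y \<notin> P" for c x y
  proof -
    obtain V v w where f: "(V, v, w) \<in> flags C" and cf: "c = flag_triangle V v w"
      using c by (rule refineE)
    note m = flag_triangle_marks[OF P f]
    have fs: "(V, w, v) \<in> flags C" using f by (rule flags_swap)
    \<comment> \<open>\<open>x\<close> is not the centroid; and if \<open>x\<close> is the midpoint, then \<open>v\<close> is marked, so \<open>y\<close> is not \<open>v\<close>\<close>
    consider "x = v" "y = centroid V" | "x = v" "y = midpoint v w" "w \<notin> P"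
      | "x = midpoint v w" "y = centroid V"
      using x y m cf by (auto simp: flag_triangle_def)
    then show ?thesis
    proof cases
      case 1
      obtain u where u: "V = {v, w, u}" "u \<noteq> v" "u \<noteq> w"
        using flag_third_vertex[OF C f] .
      have g: "(V, v, u) \<in> flags C" using f u by (auto simp: flags_def)
      show ?thesis
      proof (intro ex1I[of _ "flag_triangle V v u"] conjI)
        show "flag_triangle V v u \<noteq> c"
          using flag_triangle_inject(3)[OF C g f] u cf by auto
        fix c'
        assume c': "c' \<in> refine C \<and> c' \<noteq> c \<and> {x, y} \<subseteq> c'"
        then obtain V' v' w' where f': "(V', v', w') \<in> flags C" "c' = flag_triangle V' v' w'"
          by (blast elim: refineE)
        have "v' = v" "V' = V"
          using flag_face_iff[OF C f f'(1)] c' f'(2) 1 by auto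
        then have "w' = u" using f' u c' cf by (auto simp: flags_def)
        then show "c' = flag_triangle V v u" using f' \<open>v' = v\<close> \<open>V' = V\<close> by simp
      qed (use g refineI 1 in \<open>auto simp: flag_triangle_def\<close>)
    next
      case 2
      have Vf: "V \<in> C" "{v, w} \<subseteq> V" "v \<noteq> w" using f by (auto simp: flags_def)
      have ex: "\<exists>!V'. V' \<in> C \<and> V' \<noteq> V \<and> {v, w} \<subseteq> V'"
        using collar_half[OF col Vf(1,2)] x 2 by auto
      then obtain V1 where V1: "V1 \<in> C" "V1 \<noteq> V" "{v, w} \<subseteq> V1" by blast
      have g: "(V1, v, w) \<in> flags C" using V1 Vf by (auto simp: flags_def)
      show ?thesis
      proof (intro ex1I[of _ "flag_triangle V1 v w"] conjI)
        show "flag_triangle V1 v w \<noteq> c"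
          using flag_triangle_inject(1)[OF C g f] V1 cf by auto
        fix c'
        assume c': "c' \<in> refine C \<and> c' \<noteq> c \<and> {x, y} \<subseteq> c'"
        then obtain V' v' w' where f': "(V', v', w') \<in> flags C" "c' = flag_triangle V' v' w'"
          by (blast elim: refineE)
        have "v' = v" "{v, w} = {v', w'}"
          using flag_face_iff[OF C f f'(1)] c' f'(2) 2 by auto
        then have "v' = v" "w' = w" by (auto simp: doubleton_eq_iff)
        moreover from this have "V' \<noteq> V" "V' \<in> C" "{v, w} \<subseteq> V'"
          using f' c' cf by (auto simp: flags_def)
        then have "V' = V1" using ex V1 by blast
        ultimately show "c' = flag_triangle V1 v w" using f' by simp
      qed (use g refineI 2 in \<open>auto simp: flag_triangle_def\<close>)
    next
      case 3
      show ?thesis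
      proof (intro ex1I[of _ "flag_triangle V w v"] conjI)
        show "flag_triangle V w v \<noteq> c"
          using flag_triangle_inject(2)[OF C fs f] f cf by (auto simp: flags_def)
        fix c'
        assume c': "c' \<in> refine C \<and> c' \<noteq> c \<and> {x, y} \<subseteq> c'"
        then obtain V' v' w' where f': "(V', v', w') \<in> flags C" "c' = flag_triangle V' v' w'"
          by (blast elim: refineE)
        have "{v, w} = {v', w'}" "V' = V"
          using flag_face_iff[OF C f f'(1)] c' f'(2) 3 by auto
        then show "c' = flag_triangle V w v" using f' c' cf by (auto simp: doubleton_eq_iff)
      qed (use refineI[OF fs] 3 in \<open>auto simp: flag_triangle_def midpoint_sym\<close>)
    qed
  qed
  have inside: "c = c'"
    if c: "c \<in> refine C" "c' \<in> refine C" and xy: "x \<in> P" "y \<in> P" "x \<noteq> y" "{x, y} \<subseteq> c \<inter> c'"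
    for c c' x y
  proof -
    obtain V v w where f: "(V, v, w) \<in> flags C" "c = flag_triangle V v w"
      using c(1) by (rule refineE)
    obtain V' v' w' where f': "(V', v', w') \<in> flags C" "c' = flag_triangle V' v' w'"
      using c(2) by (rule refineE)
    note m = flag_triangle_marks[OF P f(1)]
    have e: "{x, y} = {v, midpoint v w}" "v \<in> P" "w \<in> P"
      using xy m f by (auto simp: flag_triangle_def)
    then have "{v, midpoint v w} \<subseteq> c'" using xy by auto
    then have "v = v'" "{v, w} = {v', w'}"
      using flag_face_iff[OF C f(1) f'(1)] f' by auto
    then have "v = v'" "w = w'" by (auto simp: doubleton_eq_iff)
    moreover have "V = V'"
      using collar_inside[OF col, of V V' v w] f f' e calculation by (auto simp: flags_def)
    ultimately show ?thesis using f f' by simp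
  qed
  have outside: "c = c'"
    if c: "c \<in> touching (refine C) P" "c' \<in> touching (refine C) P"
      and xy: "x \<notin> P" "y \<notin> P" "x \<noteq> y" "{x, y} \<subseteq> c \<inter> c'" for c c' x y
  proof -
    have cr: "c \<in> refine C" "c' \<in> refine C" using c by (auto simp: touching_def)
    obtain V v w where f: "(V, v, w) \<in> flags C" "c = flag_triangle V v w"
      using cr(1) by (rule refineE)
    obtain V' v' w' where f': "(V', v', w') \<in> flags C" "c' = flag_triangle V' v' w'"
      using cr(2) by (rule refineE)
    note m = flag_triangle_marks[OF P f(1)]
    have vP: "v \<in> P" "v' \<in> P"
      using flag_triangle_touching[OF P] f f' c by auto
    then have e: "{x, y} = {midpoint v w, centroid V}" "w \<notin> P"
      using xy m f by (auto simp: flag_triangle_def)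
    then have "{midpoint v w, centroid V} \<subseteq> c'" using xy by auto
    then have "{v, w} = {v', w'}" "V = V'"
      using flag_face_iff[OF C f(1) f'(1)] f' by auto
    moreover from this have "v = v'" "w = w'" using e vP by (auto simp: doubleton_eq_iff)
    ultimately show ?thesis using f f' by simp
  qed
  show ?thesis
    unfolding collar_def
  proof (intro conjI ballI allI impI)
    show "\<exists>!c'. c' \<in> refine C \<and> c' \<noteq> c \<and> {x, y} \<subseteq> c'"
      if "c \<in> refine C" "x \<in> c \<inter> P" "y \<in> c - P" for c x y
      using that by (intro half) auto
    show "c = c'"
      if "c \<in> refine C" "c' \<in> refine C" "x \<in> P" "y \<in> P" "x \<noteq> y \<and> {x, y} \<subseteq> c \<inter> c'" for c c' x y
      using inside that by blast
    show "c = c'"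
      if "c \<in> touching (refine C) P" "c' \<in> touching (refine C) P"
        "x \<notin> P \<and> y \<notin> P \<and> x \<noteq> y \<and> {x, y} \<subseteq> c \<inter> c'" for c c' x y
      using outside that by blast
    show "(touching_step (refine C) P)\<^sup>*\<^sup>* c c'"
      if "c \<in> touching (refine C) P" "c' \<in> touching (refine C) P" for c c'
      using refine_touching_connected[OF assms that] .
  qed
qed

lemma iterated_collar:
  assumes "embedded C" "collar C P" "\<And>n. marking ((refine ^^ n) C) P"
  shows "collar ((refine ^^ n) C) P"
proof -
  have "embedded ((refine ^^ n) C)" for n
    by (induction n) (simp_all add: assms refine_embedded)
  then show ?thesis
    by (induction n) (simp_all add: assms refine_collar)
qed

text \<open>
  Let \<open>p\<close> be a marked and \<open>q\<close> an unmarked vertex, and \<open>r\<close> the third one.  Of the three sides exactly two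
  have one marked endpoint, namely \<open>pq\<close> and either \<open>rq\<close> or \<open>pr\<close>; each of them has one neighbour, and
  no touching triangle lies across the third side.
\<close>

lemma collar_degree:
  assumes C: "embedded C" and col: "collar C P"
    and V: "V \<in> touching C P" "\<not> V \<subseteq> P"
  shows "card {V' \<in> touching C P. V' \<noteq> V \<and> share_side V V'} = 2"
proof -
  have VC: "V \<in> C" using V by (simp add: touching_def)
  have c3: "card V = 3" using embedded_card[OF C VC] .
  obtain p q where p: "p \<in> V" "p \<in> P" and q: "q \<in> V" "q \<notin> P"
    using V by (auto simp: touching_def)
  then have "(V, p, q) \<in> flags C" using VC by (auto simp: flags_def)
  then obtain r where r: "V = {p, q, r}" "r \<noteq> p" "r \<noteq> q"
    using flag_third_vertex[OF C] by metis
  have nosub: "V' = V" if "V' \<in> C" "{p, q, r} \<subseteq> V'" for V'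
    using that r card_subset_eq[OF embedded_finite[OF C that(1)], of V] embedded_card[OF C that(1)] c3
    by auto
  have share: "share_side V V' \<longleftrightarrow> {p, q} \<subseteq> V' \<or> {p, r} \<subseteq> V' \<or> {q, r} \<subseteq> V'" for V'
  proof
    assume "share_side V V'"
    then obtain x y where "x \<noteq> y" "x \<in> V" "y \<in> V" "{x, y} \<subseteq> V'"
      unfolding share_side_def by auto
    then show "{p, q} \<subseteq> V' \<or> {p, r} \<subseteq> V' \<or> {q, r} \<subseteq> V'"
      unfolding r(1) by auto
  next
    have "p \<noteq> q" "p \<noteq> r" "q \<noteq> r" using p q r by auto
    moreover assume "{p, q} \<subseteq> V' \<or> {p, r} \<subseteq> V' \<or> {q, r} \<subseteq> V'"
    ultimately show "share_side V V'"
      unfolding share_side_def r(1) by blast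
  qed
  define side_of where "side_of s V' \<longleftrightarrow> V' \<in> C \<and> V' \<noteq> V \<and> s \<subseteq> V'" for s V'
  \<comment> \<open>the second side with exactly one marked endpoint\<close>
  define e where "e = (if r \<in> P then {r, q} else {p, r})"
  have ex1: "\<exists>!V'. side_of {p, q} V'"
    unfolding side_of_def using p q VC by (intro collar_half[OF col]) auto
  have ex2: "\<exists>!V'. side_of e V'"
  proof (cases "r \<in> P")
    case True
    then show ?thesis
      unfolding side_of_def e_def if_P[OF True] using q r(1) VC by (intro collar_half[OF col]) auto
  next
    case False
    then show ?thesis
      unfolding side_of_def e_def if_not_P[OF False] using p r(1) VC
      by (intro collar_half[OF col]) auto
  qed
  obtain V1 V2 where V12: "side_of {p, q} V1" "side_of e V2"
    using ex1 ex2 by blast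
  have "{V' \<in> touching C P. V' \<noteq> V \<and> share_side V V'} = {V1, V2}"
  proof (intro equalityI subsetI)
    fix V'
    assume "V' \<in> {V1, V2}"
    then show "V' \<in> {V' \<in> touching C P. V' \<noteq> V \<and> share_side V V'}"
      using V12 p unfolding share
      by (auto simp: side_of_def e_def touching_def split: if_splits)
  next
    fix V'
    assume "V' \<in> {V' \<in> touching C P. V' \<noteq> V \<and> share_side V V'}"
    then have V': "V' \<in> touching C P" "V' \<in> C" "V' \<noteq> V"
      "{p, q} \<subseteq> V' \<or> {p, r} \<subseteq> V' \<or> {q, r} \<subseteq> V'"
      unfolding share by (auto simp: touching_def)
    have "side_of {p, q} V' \<or> side_of e V'"
    proof (cases "r \<in> P")
      case True
      then have "\<not> {p, r} \<subseteq> V'"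
        using collar_inside[OF col VC V'(2), of p r] V'(3) p r by auto
      then show ?thesis using V' True by (auto simp: side_of_def e_def)
    next
      case False
      then have "\<not> {q, r} \<subseteq> V'"
        using collar_outside[OF col V(1) V'(1), of q r] V'(3) q r by auto
      then show ?thesis using V' False by (auto simp: side_of_def e_def)
    qed
    then show "V' \<in> {V1, V2}" using V12 ex1 ex2 by blast
  qed
  moreover have "V1 \<noteq> V2"
    using V12 nosub[of V1] r by (auto simp: side_of_def e_def split: if_splits)
  ultimately show ?thesis by simp
qed

section \<open>Counting marked vertices\<close>

definition ordered_pairs :: "'a set \<Rightarrow> ('a \<times> 'a) set" where
  "ordered_pairs V = {(v, w). v \<in> V \<and> w \<in> V \<and> v \<noteq> w}"

lemma sum_ordered_pairs:
  fixes g :: "'a \<Rightarrow> 'a \<Rightarrow> nat"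
  assumes "a \<noteq> b" "a \<noteq> c" "b \<noteq> c"
  shows "(\<Sum>(v, w)\<in>ordered_pairs {a, b, c}. g v w) =
    g a b + g a c + g b a + g b c + g c a + g c b"
proof -
  have "ordered_pairs {a, b, c} = {(a, b), (a, c), (b, a), (b, c), (c, a), (c, b)}"
    using assms by (auto simp: ordered_pairs_def)
  then show ?thesis using assms by simp
qed

text \<open>
  Each refined triangle comes from exactly one flag, so sums over the refinement are sums over flags.
\<close>

lemma sum_refine:
  assumes C: "embedded C" and fin: "finite C"
  shows "sum g (refine C) = (\<Sum>V\<in>C. \<Sum>(v, w)\<in>ordered_pairs V. g (flag_triangle V v w))"
proof -
  have flags: "flags C = (SIGMA V:C. ordered_pairs V)"
    by (auto simp: flags_def ordered_pairs_def)
  have finp: "finite (ordered_pairs V)" if "V \<in> C" for V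
    by (rule finite_subset[of _ "V \<times> V"]) (auto simp: ordered_pairs_def embedded_finite[OF C that])
  have "inj_on (\<lambda>(V, v, w). flag_triangle V v w) (flags C)"
  proof (rule inj_onI)
    fix f f'
    assume ff: "f \<in> flags C" "f' \<in> flags C"
      and eq: "(case f of (V, v, w) \<Rightarrow> flag_triangle V v w) = (case f' of (V, v, w) \<Rightarrow> flag_triangle V v w)"
    obtain V v w V' v' w' where f: "f = (V, v, w)" "f' = (V', v', w')"
      by (metis prod_cases3)
    show "f = f'"
      using flag_triangle_inject[OF C, of V v w V' v' w'] ff eq unfolding f by simp
  qed
  moreover have "refine C = (\<lambda>(V, v, w). flag_triangle V v w) ` flags C"
    by (force simp: refine_def)
  ultimately have "sum g (refine C) = (\<Sum>(V, v, w)\<in>flags C. g (flag_triangle V v w))"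
    by (simp add: sum.reindex case_prod_unfold)
  also have "\<dots> = (\<Sum>V\<in>C. \<Sum>(v, w)\<in>ordered_pairs V. g (flag_triangle V v w))"
    unfolding flags
    using fin finp sum.Sigma[of C ordered_pairs "\<lambda>V (v, w). g (flag_triangle V v w)"]
    by (simp add: case_prod_unfold)
  finally show ?thesis .
qed

lemma card_marked_flag_triangle:
  assumes C: "embedded C" and P: "marking C P" and f: "(V, v, w) \<in> flags C"
  shows "card (flag_triangle V v w \<inter> P) = (if v \<in> P then if w \<in> P then 2 else 1 else 0)"
  using flag_triangle_marks[OF P f] flag_distinct[OF C f]
  by (auto simp: flag_triangle_def Int_insert_left)

text \<open>
  In a triangle with \<open>k\<close> marked vertices, \<open>2 * k\<close> of the six ordered pairs of vertices start in a
  marked vertex, and \<open>k * (k - 1)\<close> of them have both entries marked.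
\<close>

lemma refine_marked_counts:
  assumes C: "embedded C" and fin: "finite C" and P: "marking C P"
  shows "card (touching (refine C) P) = 2 * (\<Sum>V\<in>C. card (V \<inter> P))"
    and "(\<Sum>c\<in>refine C. card (c \<inter> P)) =
      2 * (\<Sum>V\<in>C. card (V \<inter> P)) + (\<Sum>V\<in>C. card (V \<inter> P) * (card (V \<inter> P) - 1))"
    and "(\<Sum>c\<in>refine C. card (c \<inter> P) * (card (c \<inter> P) - 1)) =
      2 * (\<Sum>V\<in>C. card (V \<inter> P) * (card (V \<inter> P) - 1))"
proof -
  \<comment> \<open>the six flag triangles sorted by their number of marked vertices, by cases on that number for \<open>V\<close>\<close>
  have sums: "(\<Sum>(v, w)\<in>ordered_pairs V. h (card (flag_triangle V v w \<inter> P))) =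
      (if card (V \<inter> P) = 0 then 6 * h 0 else if card (V \<inter> P) = 1 then 2 * h 1 + 4 * h 0
       else if card (V \<inter> P) = 2 then 2 * h 2 + 2 * h 1 + 2 * h 0 else 6 * h 2)
      \<and> card (V \<inter> P) \<le> 3"
    if V: "V \<in> C" for V and h :: "nat \<Rightarrow> nat"
  proof -
    obtain a b c where abc: "V = {a, b, c}" "a \<noteq> b" "a \<noteq> c" "b \<noteq> c"
      using embedded_card[OF C V] by (auto simp: card_3_iff)
    have "card (flag_triangle V v w \<inter> P) = (if v \<in> P then if w \<in> P then 2 else 1 else 0)"
      if "(v, w) \<in> ordered_pairs V" for v w
      using that V by (intro card_marked_flag_triangle[OF C P]) (auto simp: flags_def ordered_pairs_def)
    then have "(\<Sum>(v, w)\<in>ordered_pairs V. h (card (flag_triangle V v w \<inter> P))) =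
        (\<Sum>(v, w)\<in>ordered_pairs V. h (if v \<in> P then if w \<in> P then 2 else 1 else 0))"
      by (intro sum.cong) auto
    then show ?thesis
      using abc by (cases "a \<in> P"; cases "b \<in> P"; cases "c \<in> P")
        (simp_all add: sum_ordered_pairs Int_insert_left)
  qed
  have le: "card (V \<inter> P) \<in> {0, 1, 2, 3}" if "V \<in> C" for V
    using sums[OF that, of id] by auto
  have "card (touching (refine C) P) = (\<Sum>c\<in>refine C. if card (c \<inter> P) = 0 then 0 else 1)"
  proof -
    have "touching (refine C) P = refine C \<inter> - {c. card (c \<inter> P) = 0}"
      using embedded_finite[OF refine_embedded[OF C]] by (auto simp: touching_def card_gt_0_iff)
    then show ?thesis
      using finite_refine[OF C fin] by (simp add: sum.If_cases)
  qed
  also have "\<dots> = (\<Sum>V\<in>C. 2 * card (V \<inter> P))"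
    unfolding sum_refine[OF C fin]
  proof (intro sum.cong refl)
    fix V
    assume "V \<in> C"
    note le[OF this] and e = conjunct1[OF sums[OF this, of "\<lambda>k. if k = 0 then 0 else 1"]]
    then show "(\<Sum>(v, w)\<in>ordered_pairs V. if card (flag_triangle V v w \<inter> P) = 0 then 0 else 1) =
        2 * card (V \<inter> P)"
      unfolding e by auto
  qed
  finally show "card (touching (refine C) P) = 2 * (\<Sum>V\<in>C. card (V \<inter> P))"
    by (simp add: sum_distrib_left)
  have "(\<Sum>c\<in>refine C. card (c \<inter> P)) =
      (\<Sum>V\<in>C. 2 * card (V \<inter> P) + card (V \<inter> P) * (card (V \<inter> P) - 1))"
    unfolding sum_refine[OF C fin]
  proof (intro sum.cong refl)
    fix V
    assume "V \<in> C"
    note le[OF this] and e = conjunct1[OF sums[OF this, of "\<lambda>k. k"]]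
    then show "(\<Sum>(v, w)\<in>ordered_pairs V. card (flag_triangle V v w \<inter> P)) =
        2 * card (V \<inter> P) + card (V \<inter> P) * (card (V \<inter> P) - 1)"
      unfolding e by auto
  qed
  then show "(\<Sum>c\<in>refine C. card (c \<inter> P)) =
      2 * (\<Sum>V\<in>C. card (V \<inter> P)) + (\<Sum>V\<in>C. card (V \<inter> P) * (card (V \<inter> P) - 1))"
    by (simp add: sum.distrib sum_distrib_left)
  have "(\<Sum>c\<in>refine C. card (c \<inter> P) * (card (c \<inter> P) - 1)) =
      (\<Sum>V\<in>C. 2 * (card (V \<inter> P) * (card (V \<inter> P) - 1)))"
    unfolding sum_refine[OF C fin]
  proof (intro sum.cong refl)
    fix V
    assume "V \<in> C"
    note le[OF this] and e = conjunct1[OF sums[OF this, of "\<lambda>k. k * (k - 1)"]]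
    then show "(\<Sum>(v, w)\<in>ordered_pairs V.
          card (flag_triangle V v w \<inter> P) * (card (flag_triangle V v w \<inter> P) - 1)) =
        2 * (card (V \<inter> P) * (card (V \<inter> P) - 1))"
      unfolding e by auto
  qed
  then show "(\<Sum>c\<in>refine C. card (c \<inter> P) * (card (c \<inter> P) - 1)) =
      2 * (\<Sum>V\<in>C. card (V \<inter> P) * (card (V \<inter> P) - 1))"
    by (simp add: sum_distrib_left)
qed

section \<open>Marking the frontier\<close>

text \<open>
  Here \<open>\<F>\<close> is meant to be a set of proper faces of \<open>T\<close> that covers its frontier.  The last conjunct
  excludes chords: vertices of one triangle that lie in the union of \<open>\<F>\<close> lie in one common member.
\<close>

definition chord_free :: "'a::real_vector set set \<Rightarrow> 'a set \<Rightarrow> 'a set set \<Rightarrow> bool" where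
  "chord_free C T \<F> \<longleftrightarrow> (\<forall>V\<in>C. V \<subseteq> T \<and> (\<forall>F\<in>\<F>. \<not> V \<subseteq> F) \<and>
     (\<forall>x\<in>V \<inter> \<Union>\<F>. \<forall>y\<in>V \<inter> \<Union>\<F>. \<exists>F\<in>\<F>. x \<in> F \<and> y \<in> F))"

text \<open>
  A face of \<open>T\<close> that contains an interior point of a segment in \<open>T\<close> contains its ends.  Thus a midpoint
  in a face forces both ends of its side into that face, and a centroid in a face forces all of \<open>V\<close>
  into it.  Conversely, two marked ends lie in a common face, which is convex and so contains their
  midpoint.
\<close>

lemma chord_free_marking:
  fixes T :: "'a::real_normed_vector set"
  assumes C: "embedded C" and cf: "chord_free C T \<F>"
    and T: "convex T" and F: "\<And>F. F \<in> \<F> \<Longrightarrow> F face_of T"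
  shows "marking C (\<Union>\<F>)"
  unfolding marking_def
proof (intro ballI conjI impI)
  fix V
  assume V: "V \<in> C"
  then have VT: "V \<subseteq> T" and VF: "\<And>F. F \<in> \<F> \<Longrightarrow> \<not> V \<subseteq> F"
    using cf by (auto simp: chord_free_def)
  show "centroid V \<notin> \<Union>\<F>"
  proof
    assume "centroid V \<in> \<Union>\<F>"
    then obtain F where F': "F \<in> \<F>" "centroid V \<in> F" by blast
    obtain v w u where V3: "V = {v, w, u}" "v \<noteq> w" "v \<noteq> u" "w \<noteq> u"
      using embedded_card[OF C V] by (auto simp: card_3_iff)
    have "centroid {v} \<noteq> centroid {w, u}"
      using centroid_inject[OF C V V, of "{v}" "{w, u}"] V3 by auto
    then have ne: "v \<noteq> midpoint w u" using V3 by (simp add: centroid_pair)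
    \<comment> \<open>the centroid divides the median from \<open>v\<close> in the ratio 2 : 1\<close>
    have "centroid V = (1 - 2/3) *\<^sub>R v + (2/3) *\<^sub>R midpoint w u"
      using V3 by (simp add: centroid_def midpoint_def algebra_simps)
    then have "centroid V \<in> open_segment v (midpoint w u)"
      using ne by (auto simp: in_segment intro!: exI[of _ "2/3"])
    moreover have "midpoint w u \<in> T"
      using VT V3 T by (meson closed_segment_subset insert_subset midpoints_in_convex_hull midpoint_in_closed_segment subsetD)
    ultimately have "v \<in> F" "midpoint w u \<in> F"
      using F[OF F'(1)] F'(2) VT V3 unfolding face_of_def by blast+
    moreover have "midpoint w u \<in> open_segment w u" using V3 by simp
    ultimately have "V \<subseteq> F"
      using F[OF F'(1)] VT V3 unfolding face_of_def by blast
    then show False using VF F' by blast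
  qed
  fix x y
  assume xy: "x \<in> V" "y \<in> V" "x \<noteq> y"
  show "midpoint x y \<in> \<Union>\<F> \<longleftrightarrow> x \<in> \<Union>\<F> \<and> y \<in> \<Union>\<F>"
  proof
    assume "midpoint x y \<in> \<Union>\<F>"
    then obtain G where G: "G \<in> \<F>" "midpoint x y \<in> G" by blast
    moreover have "midpoint x y \<in> open_segment x y" using xy by simp
    ultimately have "x \<in> G \<and> y \<in> G"
      using F[OF G(1)] VT xy unfolding face_of_def by blast
    then show "x \<in> \<Union>\<F> \<and> y \<in> \<Union>\<F>" using G by blast
  next
    assume "x \<in> \<Union>\<F> \<and> y \<in> \<Union>\<F>"
    then obtain G where G: "G \<in> \<F>" "x \<in> G" "y \<in> G"
      using cf V xy unfolding chord_free_def by blast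
    then have "midpoint x y \<in> G"
      using face_of_imp_convex[OF F[OF G(1)]] closed_segment_subset midpoint_in_closed_segment by blast
    then show "midpoint x y \<in> \<Union>\<F>" using G by blast
  qed
qed

text \<open>
  The centroid of a refined triangle is unmarked, so marked pairs can only be formed by \<open>v\<close> and the
  midpoint of \<open>v\<close> and \<open>w\<close>; then \<open>v\<close> and \<open>w\<close> are marked and lie in a common face together with it.
\<close>

lemma chord_free_refine:
  fixes T :: "'a::real_normed_vector set"
  assumes C: "embedded C" and cf: "chord_free C T \<F>"
    and T: "convex T" and F: "\<And>F. F \<in> \<F> \<Longrightarrow> F face_of T"
  shows "chord_free (refine C) T \<F>"
  unfolding chord_free_def
proof (intro ballI)
  note P = chord_free_marking[OF assms]
  fix c
  assume "c \<in> refine C"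
  then obtain V v w where f: "(V, v, w) \<in> flags C" and c: "c = flag_triangle V v w"
    by (rule refineE)
  note m = flag_triangle_marks[OF P f]
  have V: "V \<in> C" "v \<in> V" "w \<in> V" "v \<noteq> w" using f by (auto simp: flags_def)
  have VT: "V \<subseteq> T" using cf V by (simp add: chord_free_def)
  have "midpoint v w \<in> T"
    using V VT T closed_segment_subset midpoint_in_closed_segment by blast
  moreover have "centroid V \<in> T"
  proof -
    have "(\<Sum>p\<in>V. (1 / real (card V)) *\<^sub>R p) \<in> T"
      using embedded_card[OF C V(1)] embedded_finite[OF C V(1)] VT
      by (intro convex_sum[OF _ T]) auto
    then show ?thesis by (simp add: centroid_def scaleR_sum_right)
  qed
  ultimately have "c \<subseteq> T" using V VT c by (auto simp: flag_triangle_def)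
  moreover have "\<not> c \<subseteq> F" if "F \<in> \<F>" for F
    using m(1) that c by (auto simp: flag_triangle_def)
  moreover have "\<exists>F\<in>\<F>. x \<in> F \<and> y \<in> F" if xy: "x \<in> c \<inter> \<Union>\<F>" "y \<in> c \<inter> \<Union>\<F>" for x y
  proof -
    have x: "x = v \<and> v \<in> \<Union>\<F> \<or> x = midpoint v w \<and> v \<in> \<Union>\<F> \<and> w \<in> \<Union>\<F>"
      and y: "y = v \<and> v \<in> \<Union>\<F> \<or> y = midpoint v w \<and> v \<in> \<Union>\<F> \<and> w \<in> \<Union>\<F>"
      using xy m unfolding c flag_triangle_def by blast+
    show ?thesis
    proof (cases "w \<in> \<Union>\<F>")
      case True
      then obtain G where G: "G \<in> \<F>" "v \<in> G" "w \<in> G"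
        using cf V x unfolding chord_free_def by blast
      then have "midpoint v w \<in> G"
        using face_of_imp_convex[OF F[OF G(1)]] closed_segment_subset midpoint_in_closed_segment
        by blast
      then show ?thesis using G x y by blast
    next
      case False
      then show ?thesis using x y by blast
    qed
  qed
  ultimately show "c \<subseteq> T \<and> (\<forall>F\<in>\<F>. \<not> c \<subseteq> F) \<and>
      (\<forall>x\<in>c \<inter> \<Union>\<F>. \<forall>y\<in>c \<inter> \<Union>\<F>. \<exists>F\<in>\<F>. x \<in> F \<and> y \<in> F)"
    by (intro conjI ballI)
qed

lemma triangle_chord_free:
  fixes a b c :: "'a::euclidean_space"
  assumes ai: "\<not> affine_dependent {a, b, c}" and ne: "a \<noteq> b" "b \<noteq> c" "a \<noteq> c"
  defines "\<F> \<equiv> {closed_segment a b, closed_segment b c, closed_segment c a}"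
  shows "F \<in> \<F> \<Longrightarrow> F face_of convex hull {a, b, c}"
    and "chord_free {{a, b, c}} (convex hull {a, b, c}) \<F>"
proof -
  show "F face_of convex hull {a, b, c}" if "F \<in> \<F>"
  proof -
    have "F = convex hull {a, b} \<or> F = convex hull {b, c} \<or> F = convex hull {c, a}"
      using that by (auto simp: \<F>_def segment_convex_hull)
    then have "\<exists>s. s \<subseteq> {a, b, c} \<and> F = convex hull s"
    proof (elim disjE)
      assume "F = convex hull {a, b}"
      then show ?thesis by (intro exI[of _ "{a, b}"]) simp
    next
      assume "F = convex hull {b, c}"
      then show ?thesis by (intro exI[of _ "{b, c}"]) simp
    next
      assume "F = convex hull {c, a}"
      then show ?thesis by (intro exI[of _ "{c, a}"]) simp
    qed
    then show ?thesis using face_of_convex_hull_affine_independent[OF ai] by simp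
  qed
  have out: "x \<notin> closed_segment y z" if "x \<in> {a, b, c}" "{y, z} \<subseteq> {a, b, c} - {x}" for x y z
  proof
    assume "x \<in> closed_segment y z"
    then have "x \<in> affine hull {y, z}"
      using convex_hull_subset_affine_hull[of "{y, z}"] by (auto simp: segment_convex_hull)
    then have "x \<in> affine hull ({a, b, c} - {x})"
      using hull_mono[OF that(2), of affine] by blast
    then show False using ai that(1) unfolding affine_dependent_def by blast
  qed
  have "\<not> {a, b, c} \<subseteq> F" if "F \<in> \<F>" for F
    using that out[of c a b] out[of a b c] out[of b c a] ne by (auto simp: \<F>_def)
  moreover have "\<exists>F\<in>\<F>. x \<in> F \<and> y \<in> F" if "x \<in> {a, b, c}" "y \<in> {a, b, c}" for x y
    using that by (auto simp: \<F>_def)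
  ultimately show "chord_free {{a, b, c}} (convex hull {a, b, c}) \<F>"
    using hull_subset[of "{a, b, c}" convex] unfolding chord_free_def by blast
qed

lemma collar_singleton:
  assumes "V \<subseteq> P"
  shows "collar {V} P"
  using assms by (auto simp: collar_def touching_def)

lemma iterated_frontier_counts:
  assumes V: "embedded {V}" "V \<subseteq> P" and P: "\<And>n. marking ((refine ^^ n) {V}) P"
  shows "card (touching ((refine ^^ Suc n) {V}) P) = 3 * Suc n * 2 ^ Suc n"
proof -
  let ?C = "\<lambda>n. (refine ^^ n) {V}"
  note C = iterated_refine[OF V(1)]
  have VP: "V \<inter> P = V" "card V = 3" using V embedded_card by blast+
  have pairs: "(\<Sum>W\<in>?C n. card (W \<inter> P) * (card (W \<inter> P) - 1)) = 6 * 2 ^ n" for n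
  proof (induction n)
    case 0
    then show ?case using VP by simp
  next
    case (Suc n)
    then show ?case using refine_marked_counts(3)[of "?C n" P] C[of n] P[of n] by simp
  qed
  have "(\<Sum>W\<in>?C n. card (W \<inter> P)) = 3 * Suc n * 2 ^ n" for n
  proof (induction n)
    case 0
    then show ?case using VP by simp
  next
    case (Suc n)
    then show ?case
      using refine_marked_counts(2)[of "?C n" P] C[of n] P[of n] pairs[of n]
      by (simp add: algebra_simps)
  qed
  then show ?thesis
    using refine_marked_counts(1)[of "?C n" P] C[of n] P[of n] by simp
qed

section \<open>Marking the barycenter\<close>

lemma refine_keeps_vertices:
  assumes C: "embedded C" shows "\<Union>C \<subseteq> \<Union>(refine C)"
proof
  fix x
  assume "x \<in> \<Union>C"
  then obtain V where V: "V \<in> C" "x \<in> V" by blast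
  have "card V = 3" using embedded_card[OF C V(1)] .
  then obtain w where "w \<in> V" "w \<noteq> x" using V(2) by (auto simp: card_3_iff)
  then have "flag_triangle V x w \<in> refine C"
    using V by (intro refineI) (auto simp: flags_def)
  then show "x \<in> \<Union>(refine C)" by (auto simp: flag_triangle_def)
qed

lemma iterated_refine_centroid:
  assumes V: "embedded {V}"
  shows "centroid V \<in> \<Union>((refine ^^ Suc n) {V})"
proof (induction n)
  case 0
  obtain a c d where abc: "V = {a, c, d}" "a \<noteq> c"
    using embedded_card[OF V] by (auto simp: card_3_iff)
  then have "flag_triangle V a c \<in> refine {V}" by (intro refineI) (simp add: flags_def)
  moreover have "centroid V \<in> flag_triangle V a c" by (simp add: flag_triangle_def)
  ultimately have "centroid V \<in> \<Union>(refine {V})" by blast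
  then show ?case by simp
next
  case (Suc n)
  then show ?case
    using refine_keeps_vertices[of "(refine ^^ Suc n) {V}"] iterated_refine[OF V, of "Suc n"] by auto
qed

text \<open>
  A vertex is the centroid of a one-element face, hence it is not the centroid of any other face.
\<close>

lemma vertex_marking:
  assumes C: "embedded C" and b: "b \<in> \<Union>C"
  shows "marking C {b}"
  unfolding marking_def
proof (intro ballI conjI impI)
  obtain W where W: "W \<in> C" "b \<in> W" using b by blast
  fix V
  assume V: "V \<in> C"
  have ne: "centroid F \<noteq> b" if "F \<subseteq> V" "F \<noteq> {}" "F \<noteq> {b}" for F
    using centroid_inject[OF C V W(1), of F "{b}"] W(2) that by auto
  have "V \<noteq> {}" "V \<noteq> {b}" using embedded_card[OF C V] by auto
  then show "centroid V \<notin> {b}" using ne[of V] by simp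
  fix x y
  assume xy: "x \<in> V" "y \<in> V" "x \<noteq> y"
  have "midpoint x y \<noteq> b"
    using ne[of "{x, y}"] xy by (auto simp: centroid_pair doubleton_eq_iff)
  then show "midpoint x y \<in> {b} \<longleftrightarrow> x \<in> {b} \<and> y \<in> {b}" using xy by auto
qed

text \<open>
  All six triangles of the first subdivision contain the centroid and all contain a vertex of \<open>V\<close>.
  Marking the centroid or marking a superset of \<open>V\<close> thus selects the same triangles, and connectedness
  is inherited from \<open>refine_collar\<close>.  The recursion for the centroid can only start at this level,
  because the centroid of \<open>V\<close> is not yet a vertex of \<open>V\<close>.
\<close>

lemma collar_centroid:
  assumes C: "embedded {V}" and P: "marking {V} P" "V \<subseteq> P"
  shows "collar (refine {V}) {centroid V}"
proof -
  let ?C = "refine {V}" and ?b = "centroid V"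
  have flag: "\<exists>v w. (V, v, w) \<in> flags {V} \<and> c = flag_triangle V v w" if "c \<in> ?C" for c
    using that by (rule refineE) (auto simp: flags_def)
  have "touching ?C P = ?C"
  proof -
    have "c \<inter> P \<noteq> {}" if "c \<in> ?C" for c
      using flag[OF that] P(2) by (auto simp: flag_triangle_def flags_def)
    then show ?thesis by (auto simp: touching_def)
  qed
  moreover have touch: "touching ?C {?b} = ?C"
  proof -
    have "?b \<in> c" if "c \<in> ?C" for c
      using flag[OF that] by (auto simp: flag_triangle_def)
    then show ?thesis by (auto simp: touching_def)
  qed
  ultimately have step: "touching_step ?C P = touching_step ?C {?b}"
    by (intro ext) (simp add: touching_step_def)
  have conn: "(touching_step ?C {?b})\<^sup>*\<^sup>* c c'" if "c \<in> ?C" "c' \<in> ?C" for c c'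
    using collar_connected[OF refine_collar[OF C P(1) collar_singleton[OF P(2)]], of c c'] that
    by (simp add: step \<open>touching ?C P = ?C\<close>)
  have half: "\<exists>!c'. c' \<in> ?C \<and> c' \<noteq> c \<and> {?b, y} \<subseteq> c'" if c: "c \<in> ?C" and y: "y \<in> c - {?b}" for c y
  proof -
    obtain v w where f: "(V, v, w) \<in> flags {V}" and cf: "c = flag_triangle V v w"
      using flag[OF c] by blast
    obtain u where u: "V = {v, w, u}" "u \<noteq> v" "u \<noteq> w"
      using flag_third_vertex[OF C f] .
    have vw: "v \<noteq> w" using f by (simp add: flags_def)
    consider "y = v" | "y = midpoint v w" using y cf by (auto simp: flag_triangle_def)
    then show ?thesis
    proof cases
      case 1
      have g: "(V, v, u) \<in> flags {V}" using f u by (auto simp: flags_def)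
      show ?thesis
      proof (intro ex1I[of _ "flag_triangle V v u"] conjI)
        show "flag_triangle V v u \<noteq> c"
          using flag_triangle_inject(3)[OF C g f] u cf by auto
        fix c'
        assume c': "c' \<in> ?C \<and> c' \<noteq> c \<and> {?b, y} \<subseteq> c'"
        then obtain v' w' where f': "(V, v', w') \<in> flags {V}" "c' = flag_triangle V v' w'"
          using flag by blast
        have "v' = v" using mem_flag_vertex[OF C f f'(1)] c' f'(2) 1 by simp
        moreover have "w' = u" using f' calculation u(1) c' cf by (auto simp: flags_def)
        ultimately show "c' = flag_triangle V v u" using f' by simp
      qed (use refineI[OF g] 1 in \<open>auto simp: flag_triangle_def\<close>)
    next
      case 2
      have g: "(V, w, v) \<in> flags {V}" using f by (rule flags_swap)
      show ?thesis
      proof (intro ex1I[of _ "flag_triangle V w v"] conjI)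
        show "flag_triangle V w v \<noteq> c"
          using flag_triangle_inject(2)[OF C g f] vw cf by auto
        fix c'
        assume c': "c' \<in> ?C \<and> c' \<noteq> c \<and> {?b, y} \<subseteq> c'"
        then obtain v' w' where f': "(V, v', w') \<in> flags {V}" "c' = flag_triangle V v' w'"
          using flag by blast
        have "{v, w} = {v', w'}" using mem_flag_midpoint[OF C f f'(1)] c' f'(2) 2 by simp
        then show "c' = flag_triangle V w v" using f' c' cf by (auto simp: doubleton_eq_iff)
      qed (use refineI[OF g] 2 in \<open>auto simp: flag_triangle_def midpoint_sym\<close>)
    qed
  qed
  have outside: "c = c'"
    if c: "c \<in> ?C" "c' \<in> ?C" and xy: "x \<noteq> ?b" "y \<noteq> ?b" "x \<noteq> y" "{x, y} \<subseteq> c \<inter> c'" for c c' x y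
  proof -
    obtain v w where f: "(V, v, w) \<in> flags {V}" and cf: "c = flag_triangle V v w"
      using flag[OF c(1)] by blast
    obtain v' w' where f': "(V, v', w') \<in> flags {V}" "c' = flag_triangle V v' w'"
      using flag[OF c(2)] by blast
    have "{x, y} = {v, midpoint v w}" using xy cf by (auto simp: flag_triangle_def)
    then have "{v, midpoint v w} \<subseteq> c'" using xy(4) by auto
    then have "v = v'" "{v, w} = {v', w'}"
      using flag_face_iff[OF C f f'(1)] f'(2) by auto
    then show ?thesis using f' cf by (auto simp: doubleton_eq_iff)
  qed
  show ?thesis
    unfolding collar_def touch
  proof (intro conjI ballI allI impI)
    show "\<exists>!c'. c' \<in> ?C \<and> c' \<noteq> c \<and> {x, y} \<subseteq> c'"
      if "c \<in> ?C" "x \<in> c \<inter> {?b}" "y \<in> c - {?b}" for c x y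
      using half[OF that(1,3)] that(2) by simp
    show "c = c'" if "c \<in> ?C" "c' \<in> ?C" "x \<in> {?b}" "y \<in> {?b}" "x \<noteq> y \<and> {x, y} \<subseteq> c \<inter> c'"
      for c c' x y
      using that by simp
    show "c = c'" if "c \<in> ?C" "c' \<in> ?C"
      "x \<notin> {?b} \<and> y \<notin> {?b} \<and> x \<noteq> y \<and> {x, y} \<subseteq> c \<inter> c'" for c c' x y
      using outside[OF that(1,2), of x y] that(3) by simp
    show "(touching_step ?C {?b})\<^sup>*\<^sup>* c c'" if "c \<in> ?C" "c' \<in> ?C" for c c'
      using conn[OF that] .
  qed
qed

text \<open>
  Every triangle has at most one vertex in \<open>{centroid V}\<close>, so the sum of the numbers of marked vertices
  is itself the number of touching triangles, and it doubles in each step.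
\<close>

lemma iterated_central_count:
  assumes V: "embedded {V}"
  shows "card (touching ((refine ^^ Suc n) {V}) {centroid V}) = 3 * 2 ^ Suc n"
proof -
  let ?C = "\<lambda>n. (refine ^^ n) {V}" and ?b = "centroid V"
  note C = iterated_refine[OF V]
  note b = iterated_refine_centroid[OF V]
  have count: "(\<Sum>c\<in>?C n. card (c \<inter> {?b})) = card (touching (?C n) {?b})" for n
  proof -
    have "card (c \<inter> {?b}) = (if c \<inter> {?b} \<noteq> {} then 1 else 0)" for c by auto
    then show ?thesis
      using C[of n] by (simp add: touching_def sum.If_cases Collect_conj_eq)
  qed
  show ?thesis
  proof (induction n)
    case 0
    obtain a c d where abc: "V = {a, c, d}" "a \<noteq> c" "a \<noteq> d" "c \<noteq> d"
      using embedded_card[OF V] by (auto simp: card_3_iff)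
    have "card (refine {V}) = 6"
      using sum_refine[OF V, of "\<lambda>_. 1::nat"] abc
        sum_ordered_pairs[OF abc(2-4), of "\<lambda>_ _. 1"] by simp
    moreover have "touching (refine {V}) {?b} = refine {V}"
      by (auto simp: touching_def refine_def flags_def flag_triangle_def)
    ultimately show ?case by simp
  next
    case (Suc n)
    \<comment> \<open>the vertex marking is available for \<open>D\<close>, where the centroid already is a vertex\<close>
    define D where "D = ?C (Suc n)"
    have D: "embedded D" "finite D" "marking D {?b}"
      using C[of "Suc n"] vertex_marking[OF _ b[of n]] by (simp_all add: D_def)
    have "(\<Sum>c\<in>D. card (c \<inter> {?b}) * (card (c \<inter> {?b}) - 1)) = 0"
      by (intro sum.neutral) auto
    then have "(\<Sum>c\<in>refine D. card (c \<inter> {?b})) = 2 * (\<Sum>c\<in>D. card (c \<inter> {?b}))"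
      using refine_marked_counts(2)[OF D] by linarith
    then have "card (touching (?C (Suc (Suc n))) {?b}) = 2 * card (touching (?C (Suc n)) {?b})"
      using count[of "Suc (Suc n)"] count[of "Suc n"] by (simp add: D_def)
    then show ?case using Suc.IH by simp
  qed
qed

section \<open>From vertex sets to triangles\<close>

lemma vertices_convex_hull: "embedded C \<Longrightarrow> V \<in> C \<Longrightarrow> vertices (convex hull V) = V"
  by (simp add: vertices_def extreme_point_of_convex_hull_affine_independent
      embedded_affine_independent)

lemma sides_convex_hull:
  "embedded C \<Longrightarrow> V \<in> C \<Longrightarrow> sides (convex hull V) = {closed_segment v w | v w. v \<in> V \<and> w \<in> V \<and> v \<noteq> w}"
  by (simp add: sides_def vertices_convex_hull)

lemma adjacency_edges_convex_hull:
  assumes C: "embedded C" and V: "V \<in> C" "V' \<in> C"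
  shows "{convex hull V, convex hull V'} \<in> adjacency_edges ((hull) convex ` C) \<longleftrightarrow>
    V \<noteq> V' \<and> share_side V V'"
proof -
  have inj: "convex hull V = convex hull V' \<longleftrightarrow> V = V'"
    using vertices_convex_hull[OF C] V by metis
  have sym: "share_side V V' \<longleftrightarrow> sides (convex hull V) \<inter> sides (convex hull V') \<noteq> {}"
    unfolding sides_convex_hull[OF C V(1)] sides_convex_hull[OF C V(2)]
  proof
    assume "share_side V V'"
    then obtain x y where "x \<noteq> y" "{x, y} \<subseteq> V \<inter> V'" unfolding share_side_def by blast
    then show "{closed_segment v w |v w. v \<in> V \<and> w \<in> V \<and> v \<noteq> w} \<inter>
      {closed_segment v w |v w. v \<in> V' \<and> w \<in> V' \<and> v \<noteq> w} \<noteq> {}" by blast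
  next
    assume "{closed_segment v w |v w. v \<in> V \<and> w \<in> V \<and> v \<noteq> w} \<inter>
      {closed_segment v w |v w. v \<in> V' \<and> w \<in> V' \<and> v \<noteq> w} \<noteq> {}"
    then obtain x y x' y' where xy: "x \<in> V" "y \<in> V" "x \<noteq> y" "x' \<in> V'" "y' \<in> V'"
      "closed_segment x y = closed_segment x' y'" by blast
    then have "{x, y} = {x', y'}" by simp
    then have "{x, y} \<subseteq> V \<inter> V'" using xy(1,2,4,5) by (auto simp: doubleton_eq_iff)
    then show "share_side V V'" using xy(3) unfolding share_side_def by blast
  qed
  have "{s, t} \<in> adjacency_edges D \<longleftrightarrow> s \<in> D \<and> t \<in> D \<and> s \<noteq> t \<and> sides s \<inter> sides t \<noteq> {}" for s t D
    unfolding adjacency_edges_def mem_Collect_eq doubleton_eq_iff by (metis inf_commute)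
  then show ?thesis
    unfolding sym inj[symmetric] using V by blast
qed

lemma subdivision_convex_hull:
  assumes "embedded {V\<^sub>0}"
  shows "subdivision n (convex hull V\<^sub>0) = (hull) convex ` (refine ^^ n) {V\<^sub>0}"
proof (induction n)
  case 0
  then show ?case by (simp add: subdivision_def)
next
  case (Suc n)
  let ?C = "(refine ^^ n) {V\<^sub>0}"
  have C: "embedded ?C" using iterated_refine[OF assms] by blast
  have "barycentric_division (convex hull V) =
      {convex hull (flag_triangle V v w) | v w. (V, v, w) \<in> flags ?C}" if "V \<in> ?C" for V
    using vertices_convex_hull[OF C that] embedded_card[OF C that] that
    by (simp add: barycentric_division_def flag_triangle_def flags_def barycenter_def centroid_def)
  then have "(\<Union>V\<in>?C. barycentric_division (convex hull V)) =
      (\<Union>V\<in>?C. {convex hull (flag_triangle V v w) | v w. (V, v, w) \<in> flags ?C})"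
    by simp
  also have "\<dots> = (hull) convex ` refine ?C"
    unfolding refine_def by (fastforce simp: flags_def)
  finally show ?case
    using Suc by (simp add: subdivision_def barycentric_division_family_def)
qed

text \<open>
  The intersection is a face of the simplex spanned by \<open>V\<close>, and the faces of a simplex are the hulls
  of subsets of its vertices.
\<close>

lemma hull_meets_face:
  fixes T :: "'a::euclidean_space set"
  assumes C: "embedded C" and V: "V \<in> C" "V \<subseteq> T" and F: "F face_of T" and T: "convex T"
  shows "convex hull V \<inter> F \<subseteq> convex hull (V \<inter> F)"
proof -
  have "convex hull V \<subseteq> T" using V(2) T by (rule hull_minimal)
  then have "T \<inter> convex hull V = convex hull V" by blast
  then have "F \<inter> convex hull V face_of convex hull V"
    using face_of_slice[OF F convex_convex_hull[of V]] by simp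
  then obtain c where c: "c \<subseteq> V" "F \<inter> convex hull V = convex hull c"
    using face_of_convex_hull_affine_independent[OF embedded_affine_independent[OF C V(1)]] by blast
  have "c \<subseteq> F" using c(2) hull_subset[of c convex] by blast
  then show ?thesis using c hull_mono[of c "V \<inter> F" convex] by blast
qed

text \<open>
  A triangle meets the frontier only in hulls of its marked vertices.  With a single marked vertex it
  meets the frontier in that point only.  Two marked vertices lie on a common side of \<open>T\<close>, which then
  contains the side of the triangle between them.
\<close>

lemma boundary_or_point_contact:
  assumes C: "embedded C" and cf: "chord_free C T \<F>" and T: "convex T"
    and F: "\<And>F. F \<in> \<F> \<Longrightarrow> F face_of T" and V: "V \<in> C"
  shows "(\<exists>e\<in>sides (convex hull V). e \<subseteq> \<Union>\<F>) \<or> (\<exists>x. convex hull V \<inter> \<Union>\<F> = {x}) \<longleftrightarrow>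
    V \<inter> \<Union>\<F> \<noteq> {}"
proof
  have VT: "V \<subseteq> T" using cf V by (simp add: chord_free_def)
  note meets = hull_meets_face[OF C V VT F T]
  {
    assume "(\<exists>e\<in>sides (convex hull V). e \<subseteq> \<Union>\<F>) \<or> (\<exists>x. convex hull V \<inter> \<Union>\<F> = {x})"
    then show "V \<inter> \<Union>\<F> \<noteq> {}"
    proof
      assume "\<exists>e\<in>sides (convex hull V). e \<subseteq> \<Union>\<F>"
      then obtain v w where "v \<in> V" "closed_segment v w \<subseteq> \<Union>\<F>"
        using sides_convex_hull[OF C V] by auto
      then show ?thesis using ends_in_segment(1)[of v w] by blast
    next
      assume "\<exists>x. convex hull V \<inter> \<Union>\<F> = {x}"
      then obtain x G where "x \<in> convex hull V" "G \<in> \<F>" "x \<in> G" by blast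
      then have "x \<in> convex hull (V \<inter> G)" using meets by blast
      then have "V \<inter> G \<noteq> {}" by auto
      then show ?thesis using \<open>G \<in> \<F>\<close> by blast
    qed
  next
    assume "V \<inter> \<Union>\<F> \<noteq> {}"
    then obtain x where x: "x \<in> V" "x \<in> \<Union>\<F>" by blast
    show "(\<exists>e\<in>sides (convex hull V). e \<subseteq> \<Union>\<F>) \<or> (\<exists>x. convex hull V \<inter> \<Union>\<F> = {x})"
    proof (cases "V \<inter> \<Union>\<F> = {x}")
      case True
      have "convex hull V \<inter> \<Union>\<F> \<subseteq> {x}"
      proof
        fix y
        assume "y \<in> convex hull V \<inter> \<Union>\<F>"
        then obtain G where G: "G \<in> \<F>" "y \<in> convex hull V \<inter> G" by blast
        have "convex hull (V \<inter> G) \<subseteq> convex hull {x}"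
          using True G(1) by (intro hull_mono) blast
        then show "y \<in> {x}" using meets[OF G(1)] G(2) by auto
      qed
      moreover have "x \<in> convex hull V" using x(1) by (rule hull_inc)
      ultimately show ?thesis using x(2) by blast
    next
      case False
      then obtain y where y: "y \<in> V" "y \<in> \<Union>\<F>" "x \<noteq> y" using x by blast
      then obtain G where G: "G \<in> \<F>" "x \<in> G" "y \<in> G"
        using cf V x unfolding chord_free_def by blast
      then have "closed_segment x y \<subseteq> \<Union>\<F>"
        using closed_segment_subset[OF G(2,3) face_of_imp_convex[OF F[OF G(1)]]] by blast
      moreover have "closed_segment x y \<in> sides (convex hull V)"
        using sides_convex_hull[OF C V] x y by blast
      ultimately show ?thesis by blast
    qed
  }
qed

section \<open>Connected graphs in which every vertex has two neighbours\<close>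

definition cycle_edges :: "'a list \<Rightarrow> 'a set set" where
  "cycle_edges xs = {{xs ! i, xs ! (Suc i mod length xs)} | i. i < length xs}"

lemma cycle_edges_image:
  "cycle_edges xs = (\<lambda>i. {xs ! i, xs ! (Suc i mod length xs)}) ` {..<length xs}"
  by (auto simp: cycle_edges_def)

lemma Union_cycle_edges: "\<Union> (cycle_edges xs) = set xs"
proof
  show "\<Union> (cycle_edges xs) \<subseteq> set xs"
    by (auto simp: cycle_edges_image intro!: nth_mem mod_less_divisor)
  show "set xs \<subseteq> \<Union> (cycle_edges xs)"
    by (auto simp: cycle_edges_image in_set_conv_nth)
qed

lemma card_cycle_edges:
  assumes "distinct xs" "length xs \<ge> 3"
  shows "card (cycle_edges xs) = length xs"
proof -
  let ?n = "length xs"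
  have "inj_on (\<lambda>i. {xs ! i, xs ! (Suc i mod ?n)}) {..<?n}"
  proof (rule inj_onI)
    fix i j
    assume ij: "i \<in> {..<?n}" "j \<in> {..<?n}"
      and eq: "{xs ! i, xs ! (Suc i mod ?n)} = {xs ! j, xs ! (Suc j mod ?n)}"
    have nth: "xs ! k = xs ! l \<longleftrightarrow> k = l" if "k < ?n" "l < ?n" for k l
      using assms that by (simp add: nth_eq_iff_index_eq)
    have "0 < ?n" using assms(2) by linarith
    then have lt: "Suc i mod ?n < ?n" "Suc j mod ?n < ?n" by simp_all
    from eq have "i = j \<or> (i = Suc j mod ?n \<and> Suc i mod ?n = j)"
      using ij lt by (auto simp: doubleton_eq_iff nth)
    then show "i = j"
      using ij assms(2) by (auto simp: mod_Suc split: if_splits)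
  qed
  then show ?thesis
    by (simp add: cycle_edges_image card_image)
qed

lemma is_cycle_iff:
  "is_cycle E K \<longleftrightarrow> K \<subseteq> E \<and> (\<exists>xs. distinct xs \<and> length xs \<ge> 3 \<and> K = cycle_edges xs)"
  by (simp add: is_cycle_def cycle_edges_def)

text \<open>
  A longest path closes up.  By maximality both neighbours of its first vertex lie on the path, so
  one of them is at a position \<open>k \<ge> 2\<close>.  A vertex at such a position that is not the last one would
  have three neighbours: its predecessor, its successor and the first vertex.  Hence the path is a
  cycle, it contains all neighbours of its vertices, and connectedness makes it exhaust the graph.
\<close>

lemma two_regular_connected_cycle:
  fixes E :: "'a set set"
  assumes E: "\<And>s. {s} \<notin> E"
    and fin: "finite A" "A \<noteq> {}"
    and deg: "\<And>s. s \<in> A \<Longrightarrow> card {t \<in> A. {s, t} \<in> E} = 2"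
    and conn: "\<And>s t. s \<in> A \<Longrightarrow> t \<in> A \<Longrightarrow> (\<lambda>s t. s \<in> A \<and> t \<in> A \<and> {s, t} \<in> E)\<^sup>*\<^sup>* s t"
  shows "\<exists>xs. distinct xs \<and> length xs \<ge> 3 \<and> set xs = A \<and>
    (\<forall>s\<in>A. \<forall>t\<in>A. {s, t} \<in> E \<longleftrightarrow> {s, t} \<in> cycle_edges xs)"
proof -
  define path where "path xs \<longleftrightarrow> distinct xs \<and> xs \<noteq> [] \<and> set xs \<subseteq> A \<and>
      (\<forall>i. Suc i < length xs \<longrightarrow> {xs ! i, xs ! Suc i} \<in> E)" for xs
  define N where "N s = {t \<in> A. {s, t} \<in> E}" for s
  have finN: "finite (N s)" for s using fin by (simp add: N_def)
  have bound: "length xs \<le> card A" if "path xs" for xs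
    using that fin(1) by (metis card_mono distinct_card path_def)
  obtain a where "a \<in> A" using fin by blast
  then have "path [a]" by (simp add: path_def)
  then have "\<exists>xs. path xs \<and> (\<forall>ys. path ys \<longrightarrow> length ys \<le> length xs)"
    using bound
    by (intro ex_has_greatest_nat[of path "[a]" length "Suc (card A)"]) (auto simp: less_Suc_eq_le)
  then obtain xs where xs: "path xs" and max: "\<And>ys. path ys \<Longrightarrow> length ys \<le> length xs"
    by blast
  define n where "n = length xs"
  have dis: "distinct xs" and n0: "0 < n" and sub: "set xs \<subseteq> A"
    and succ: "\<And>i. Suc i < n \<Longrightarrow> {xs ! i, xs ! Suc i} \<in> E"
    using xs by (auto simp: path_def n_def)
  have nth: "xs ! k = xs ! l \<longleftrightarrow> k = l" if "k < n" "l < n" for k l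
    using dis that by (simp add: nth_eq_iff_index_eq n_def)
  have mem: "xs ! k \<in> A" if "k < n" for k
    using sub that by (auto simp: n_def)
  have inN: "xs ! k \<in> N (xs ! l)" if "k < n" "l < n" "{xs ! k, xs ! l} \<in> E" for k l
    using that mem by (simp add: N_def insert_commute)
  have "N (xs ! 0) \<subseteq> set xs"
  proof (rule ccontr)
    assume "\<not> N (xs ! 0) \<subseteq> set xs"
    then obtain t where t: "t \<in> A" "{xs ! 0, t} \<in> E" "t \<notin> set xs" by (auto simp: N_def)
    \<comment> \<open>a neighbour off the path would prolong it\<close>
    have "path (t # xs)"
      unfolding path_def
    proof (intro conjI allI impI)
      fix i
      assume "Suc i < length (t # xs)"
      then show "{(t # xs) ! i, (t # xs) ! Suc i} \<in> E"
        using succ t by (cases i) (auto simp: n_def insert_commute)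
    qed (use dis sub t in auto)
    from max[OF this] show False by simp
  qed
  moreover have "card (N (xs ! 0)) = 2"
    using deg[OF mem[OF n0]] by (simp add: N_def)
  then obtain p q where pq: "N (xs ! 0) = {p, q}" "p \<noteq> q" by (auto simp: card_2_iff)
  ultimately have "p \<in> set xs" "q \<in> set xs" by auto
  then obtain i j where ij: "p = xs ! i" "q = xs ! j" "i < n" "j < n"
    unfolding in_set_conv_nth n_def by blast
  have "xs ! 0 \<notin> N (xs ! 0)" using E by (simp add: N_def)
  then have "p \<noteq> xs ! 0" "q \<noteq> xs ! 0" using pq(1) by auto
  then have ij0: "i \<noteq> 0" "j \<noteq> 0" "i \<noteq> j" using ij(1,2) pq(2) by metis+
  obtain k where k: "2 \<le> k" "k < n" "xs ! k \<in> N (xs ! 0)"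
  proof (cases "2 \<le> i")
    case True
    then show thesis using that[of i] ij(1,3) pq(1) by simp
  next
    case False
    then have "2 \<le> j" using ij0 by linarith
    then show thesis using that[of j] ij(2,4) pq(1) by simp
  qed
  have "\<not> Suc k < n"
  proof
    assume Sk: "Suc k < n"
    have "{xs ! (k - 1), xs ! Suc k, xs ! 0} \<subseteq> N (xs ! k)"
      using inN[of "k - 1" k] inN[of "Suc k" k] inN[of 0 k] succ[of "k - 1"] succ[of k] k Sk n0
      by (simp add: insert_commute N_def)
    then have "card {xs ! (k - 1), xs ! Suc k, xs ! 0} \<le> 2"
      using card_mono[OF finN, of _ "xs ! k"] deg[OF mem[OF k(2)]] by (simp add: N_def)
    moreover have "card {xs ! (k - 1), xs ! Suc k, xs ! 0} = 3"
      using k Sk n0 by (simp add: nth)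
    ultimately show False by simp
  qed
  with k(2) have kn: "n = Suc k" by linarith
  with k(1) have n3: "3 \<le> n" by linarith
  have close: "{xs ! k, xs ! 0} \<in> E"
    using k(3) by (simp add: N_def insert_commute)
  have edge: "{xs ! i, xs ! (Suc i mod n)} \<in> E" if "i < n" for i
  proof (cases "Suc i = n")
    case True
    then show ?thesis using close kn by simp
  next
    case False
    then show ?thesis using succ[of i] that by simp
  qed
  have nbrs: "\<exists>j<n. Suc j mod n = i \<and> N (xs ! i) = {xs ! (Suc i mod n), xs ! j}" if i: "i < n" for i
  proof -
    define j where "j = (if i = 0 then n - 1 else i - 1)"
    have j: "j < n" "Suc j mod n = i"
      using i n3 by (auto simp: j_def)
    have Si: "Suc i mod n < n" using n0 by simp
    have "Suc i mod n \<noteq> j"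
      using i n3 by (auto simp: j_def mod_Suc split: if_splits)
    then have "card {xs ! (Suc i mod n), xs ! j} = 2"
      using j Si by (simp add: nth)
    moreover have "{xs ! (Suc i mod n), xs ! j} \<subseteq> N (xs ! i)"
      using edge[OF i] edge[OF j(1)] j Si i mem by (simp add: N_def insert_commute)
    moreover have "card (N (xs ! i)) = 2" using deg[OF mem[OF i]] by (simp add: N_def)
    ultimately have "N (xs ! i) = {xs ! (Suc i mod n), xs ! j}"
      using card_subset_eq[OF finN] by metis
    then show ?thesis using j by blast
  qed
  have closed: "t \<in> set xs" if s: "s \<in> set xs" and t: "t \<in> N s" for s t
  proof -
    obtain i where i: "i < n" "s = xs ! i" using s unfolding in_set_conv_nth n_def by blast
    then obtain j where "j < n" "t \<in> {xs ! (Suc i mod n), xs ! j}" using nbrs[OF i(1)] t by auto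
    then show ?thesis using n0 by (auto simp: n_def)
  qed
  have "set xs = A"
  proof
    show "A \<subseteq> set xs"
    proof
      fix t
      assume "t \<in> A"
      with mem[OF n0] have "(\<lambda>s t. s \<in> A \<and> t \<in> A \<and> {s, t} \<in> E)\<^sup>*\<^sup>* (xs ! 0) t" by (rule conn)
      then show "t \<in> set xs"
      proof (induction rule: rtranclp_induct)
        case base
        then show ?case using n0 by (simp add: n_def)
      next
        case (step s t)
        then show ?case using closed[of s t] by (simp add: N_def)
      qed
    qed
  qed (rule sub)
  moreover have "{s, t} \<in> E \<longleftrightarrow> {s, t} \<in> cycle_edges xs" if st: "s \<in> A" "t \<in> A" for s t
  proof
    assume "{s, t} \<in> E"
    then have "t \<in> N s" using st by (simp add: N_def)
    moreover obtain i where i: "i < n" "s = xs ! i"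
      using st \<open>set xs = A\<close> unfolding n_def in_set_conv_nth[symmetric] by (metis in_set_conv_nth)
    ultimately obtain j where "j < n" "Suc j mod n = i" "t = xs ! (Suc i mod n) \<or> t = xs ! j"
      using nbrs by blast
    then have "{s, t} = {xs ! i, xs ! (Suc i mod n)} \<or> {s, t} = {xs ! j, xs ! (Suc j mod n)}"
      using i by auto
    then show "{s, t} \<in> cycle_edges xs"
      using i \<open>j < n\<close> unfolding cycle_edges_def n_def by blast
  next
    assume "{s, t} \<in> cycle_edges xs"
    then obtain i where "i < n" "{s, t} = {xs ! i, xs ! (Suc i mod n)}"
      unfolding cycle_edges_def n_def by blast
    then show "{s, t} \<in> E" using edge[of i] by simp
  qed
  ultimately show ?thesis
    using dis n3 unfolding n_def by blast
qed

text \<open>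
  Any cycle through all of \<open>A\<close> uses only edges inside \<open>A\<close> and has as many of them as \<open>A\<close> has elements.
  Since the edges inside \<open>A\<close> already form one cycle, no other cycle is possible.
\<close>

lemma two_regular_connected_unique_cycle:
  fixes E :: "'a set set"
  assumes E: "\<And>e. e \<in> E \<Longrightarrow> \<exists>s t. s \<noteq> t \<and> e = {s, t}"
    and fin: "finite A" "A \<noteq> {}"
    and deg: "\<And>s. s \<in> A \<Longrightarrow> card {t \<in> A. {s, t} \<in> E} = 2"
    and conn: "\<And>s t. s \<in> A \<Longrightarrow> t \<in> A \<Longrightarrow> (\<lambda>s t. s \<in> A \<and> t \<in> A \<and> {s, t} \<in> E)\<^sup>*\<^sup>* s t"
  shows "\<exists>!K. cycle_through E A K"
    and "cycle_through E A K \<Longrightarrow> cycle_length K = card A"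
proof -
  have len: "cycle_length K = card A" "finite K" if K: "cycle_through E A K" for K
  proof -
    obtain xs where "distinct xs" "length xs \<ge> 3" "K = cycle_edges xs" "set xs = A"
      using K Union_cycle_edges unfolding cycle_through_def is_cycle_iff by metis
    then show "cycle_length K = card A" "finite K"
      by (auto simp: cycle_length_def card_cycle_edges distinct_card)
        (simp add: cycle_edges_image)
  qed
  have single: "{s} \<notin> E" for s using E[of "{s}"] by (auto simp: doubleton_eq_iff)
  have "\<exists>xs. distinct xs \<and> length xs \<ge> 3 \<and> set xs = A \<and>
      (\<forall>s\<in>A. \<forall>t\<in>A. {s, t} \<in> E \<longleftrightarrow> {s, t} \<in> cycle_edges xs)"
    by (rule two_regular_connected_cycle) (fact single fin deg conn)+
  then obtain xs where xs: "distinct xs" "length xs \<ge> 3" "set xs = A"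
    "\<And>s t. s \<in> A \<Longrightarrow> t \<in> A \<Longrightarrow> {s, t} \<in> E \<longleftrightarrow> {s, t} \<in> cycle_edges xs"
    by blast
  let ?K = "cycle_edges xs"
  have "?K \<subseteq> E"
  proof
    fix e
    assume e: "e \<in> ?K"
    then obtain s t where st: "e = {s, t}" by (auto simp: cycle_edges_def)
    then have "s \<in> A" "t \<in> A" using e xs(3) Union_cycle_edges[of xs] by auto
    then show "e \<in> E" using xs(4) e st by simp
  qed
  then have K: "cycle_through E A ?K"
    using xs Union_cycle_edges unfolding cycle_through_def is_cycle_iff by metis
  have "K = ?K" if c: "cycle_through E A K" for K
  proof (rule card_subset_eq)
    show "finite ?K" using len K by blast
    show "card K = card ?K" using len[OF c] len[OF K] by (simp add: cycle_length_def)
    show "K \<subseteq> ?K"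
    proof
      fix e
      assume e: "e \<in> K"
      then have eE: "e \<in> E" "e \<subseteq> A" using c by (auto simp: cycle_through_def is_cycle_def)
      then obtain s t where "e = {s, t}" using E by blast
      then show "e \<in> ?K" using xs(4) eE by simp
    qed
  qed
  with K show "\<exists>!K. cycle_through E A K" by blast
  show "cycle_length K = card A" if "cycle_through E A K" using len that by blast
qed

section \<open>The circumference paths\<close>

text \<open>
  Transport of degrees and connectedness along the map that sends vertex sets to their convex hulls.
  The map is injective because a triangle determines its vertices.
\<close>

lemma collar_unique_cycle:
  assumes C: "embedded C" and fin: "finite C" and col: "collar C P"
    and proper: "\<And>V. V \<in> C \<Longrightarrow> \<not> V \<subseteq> P" and ne: "touching C P \<noteq> {}"
  shows "\<exists>!K. cycle_through (adjacency_edges ((hull) convex ` C)) ((hull) convex ` touching C P) K"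
    and "cycle_through (adjacency_edges ((hull) convex ` C)) ((hull) convex ` touching C P) K \<Longrightarrow>
      cycle_length K = card (touching C P)"
proof -
  let ?E = "adjacency_edges ((hull) convex ` C)" and ?A = "(hull) convex ` touching C P"
  have sub: "V \<in> C" if "V \<in> touching C P" for V using that by (simp add: touching_def)
  have inj: "inj_on ((hull) convex) (touching C P)"
    using vertices_convex_hull[OF C] sub by (metis inj_onI)
  have E: "\<exists>s t. s \<noteq> t \<and> e = {s, t}" if "e \<in> ?E" for e
    using that unfolding adjacency_edges_def by blast
  have finA: "finite (touching C P)" using fin by (simp add: touching_def)
  then have A: "finite ?A" "?A \<noteq> {}" using ne by auto
  have deg: "card {t \<in> ?A. {s, t} \<in> ?E} = 2" if "s \<in> ?A" for s
  proof -
    obtain V where V: "V \<in> touching C P" "s = convex hull V" using \<open>s \<in> ?A\<close> by blast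
    have "{t \<in> ?A. {s, t} \<in> ?E} = (hull) convex ` {V' \<in> touching C P. V' \<noteq> V \<and> share_side V V'}"
      using adjacency_edges_convex_hull[OF C sub[OF V(1)] sub] unfolding V(2) by auto
    moreover have "inj_on ((hull) convex) {V' \<in> touching C P. V' \<noteq> V \<and> share_side V V'}"
      using inj by (rule inj_on_subset) blast
    ultimately show ?thesis
      using collar_degree[OF C col V(1) proper[OF sub[OF V(1)]]] by (simp add: card_image)
  qed
  have conn: "(\<lambda>s t. s \<in> ?A \<and> t \<in> ?A \<and> {s, t} \<in> ?E)\<^sup>*\<^sup>* s t" if "s \<in> ?A" "t \<in> ?A" for s t
  proof -
    obtain V V' where V: "V \<in> touching C P" "V' \<in> touching C P"
      and st: "s = convex hull V" "t = convex hull V'" using \<open>s \<in> ?A\<close> \<open>t \<in> ?A\<close> by blast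
    show ?thesis
      unfolding st using collar_connected[OF col V]
    proof (induction rule: rtranclp_induct)
      case base
      then show ?case by simp
    next
      case (step V1 V2)
      have t: "V1 \<in> touching C P" "V2 \<in> touching C P" "share_side V1 V2"
        using step.hyps(2) by (simp_all add: touching_step_def)
      show ?case
      proof (cases "V1 = V2")
        case True
        then show ?thesis using step.IH by simp
      next
        case False
        then have "{convex hull V1, convex hull V2} \<in> ?E"
          using adjacency_edges_convex_hull[OF C sub[OF t(1)] sub[OF t(2)]] t(3) by simp
        then show ?thesis
          using t(1,2) by (intro rtranclp.rtrancl_into_rtrancl[OF step.IH]) blast
      qed
    qed
  qed
  note cycle = two_regular_connected_unique_cycle[of ?E ?A, OF E A deg conn]
  show "\<exists>!K. cycle_through ?E ?A K"
    by (rule cycle(1))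
  show "cycle_length K = card (touching C P)" if "cycle_through ?E ?A K"
    using cycle(2)[of K] that card_image[OF inj] by simp
qed

theorem proposition5p2:
  fixes T\<^sub>0 :: "(real ^ 2) set" and n :: nat
  assumes "2 simplex T\<^sub>0" and "n \<ge> 1"
  shows "(\<exists>!K. is_Out n T\<^sub>0 K) \<and> (\<exists>!K. is_Inn n T\<^sub>0 K) \<and>
         cycle_length (Out n T\<^sub>0) = 3 * n * 2 ^ n \<and>
         cycle_length (Inn n T\<^sub>0) = 3 * 2 ^ n"
proof -
  obtain V where ai: "\<not> affine_dependent V" and "int (card V) = 2 + 1" and T: "T\<^sub>0 = convex hull V"
    using assms(1) unfolding simplex_def by blast
  then have V3: "card V = 3" by simp
  then obtain a b c where abc: "V = {a, b, c}" "a \<noteq> b" "b \<noteq> c" "a \<noteq> c"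
    by (auto simp: card_3_iff)
  obtain m where n: "n = Suc m" using assms(2) by (cases n) auto
  define \<F> where "\<F> = {closed_segment a b, closed_segment b c, closed_segment c a}"
  have face: "F face_of T\<^sub>0" if "F \<in> \<F>" for F
    using triangle_chord_free(1)[of a b c F] ai abc that unfolding T \<F>_def by simp
  have cf0: "chord_free {V} T\<^sub>0 \<F>"
    using triangle_chord_free(2)[of a b c] ai abc unfolding T \<F>_def by simp
  have front: "frontier T\<^sub>0 = \<Union>\<F>"
    using frontier_of_triangle[of a b c] unfolding T abc(1) \<F>_def by auto
  have conv: "convex T\<^sub>0" unfolding T by (rule convex_convex_hull)
  let ?P = "\<Union>\<F>" and ?b = "centroid V"
  define C where "C k = (refine ^^ k) {V}" for k
  have V0: "embedded {V}" using ai V3 by (rule embedded_singleton)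
  have C: "embedded (C k)" "finite (C k)" for k
    using iterated_refine[OF V0, of k] by (simp_all add: C_def)
  have cf: "chord_free (C k) T\<^sub>0 \<F>" for k
  proof (induction k)
    case 0
    then show ?case using cf0 by (simp add: C_def)
  next
    case (Suc k)
    then show ?case using chord_free_refine[OF C(1) Suc conv face] by (simp add: C_def)
  qed
  have markP: "marking (C k) ?P" for k
    using chord_free_marking[OF C(1) cf conv face] .
  have VP: "V \<subseteq> ?P" using abc by (auto simp: \<F>_def)
  have collarP: "collar (C k) ?P" for k
    using iterated_collar[OF V0 collar_singleton[OF VP]] markP by (simp add: C_def)
  have vertex: "?b \<in> \<Union>(C (Suc k))" for k
    using iterated_refine_centroid[OF V0] by (simp add: C_def)
  have markb: "marking (C (Suc k)) {?b}" for k
    using vertex_marking[OF C(1) vertex] .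
  have collarb: "collar (C (Suc k)) {?b}" for k
  proof -
    have "C (Suc j) = (refine ^^ j) (refine {V})" for j
      by (simp add: C_def funpow_swap1)
    then show ?thesis
      using iterated_collar[OF refine_embedded[OF V0] collar_centroid[OF V0 _ VP], of k]
        markb markP[of 0] by (simp add: C_def)
  qed
  have sub: "subdivision n T\<^sub>0 = (hull) convex ` C n"
    using subdivision_convex_hull[OF V0] by (simp add: T C_def)
  have image_filter: "{t \<in> (hull) convex ` C n. Q t} = (hull) convex ` {W \<in> C n. Q (convex hull W)}" for Q
    by blast
  have "boundary_triangles n T\<^sub>0 \<union> point_contact_triangles n T\<^sub>0 =
      {t \<in> (hull) convex ` C n. (\<exists>e\<in>sides t. e \<subseteq> ?P) \<or> (\<exists>x. t \<inter> ?P = {x})}"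
    unfolding boundary_triangles_def point_contact_triangles_def sub front Collect_disj_eq[symmetric]
    by (rule Collect_cong) argo
  also have "\<dots> = (hull) convex ` touching (C n) ?P"
    unfolding image_filter touching_def
    using boundary_or_point_contact[OF C(1) cf conv face]
    by (intro arg_cong[where f = "(`) ((hull) convex)"] Collect_cong conj_cong refl)
  finally have outer_set: "boundary_triangles n T\<^sub>0 \<union> point_contact_triangles n T\<^sub>0 =
      (hull) convex ` touching (C n) ?P" .
  then have Out_iff: "is_Out n T\<^sub>0 = cycle_through (adjacency_edges ((hull) convex ` C n))
      ((hull) convex ` touching (C n) ?P)"
    by (simp add: is_Out_def sub)
  have "barycenter T\<^sub>0 = ?b"
    using vertices_convex_hull[OF V0] V3 by (simp add: T barycenter_def centroid_def)
  then have "central_triangles n T\<^sub>0 = (hull) convex ` touching (C n) {?b}"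
    unfolding central_triangles_def sub touching_def image_filter
    using vertices_convex_hull[OF C(1)]
    by (intro arg_cong[where f = "(`) ((hull) convex)"] Collect_cong conj_cong refl) simp
  then have Inn_iff: "is_Inn n T\<^sub>0 = cycle_through (adjacency_edges ((hull) convex ` C n))
      ((hull) convex ` touching (C n) {?b})"
    by (simp add: is_Inn_def sub)
  have countP: "card (touching (C n) ?P) = 3 * n * 2 ^ n"
    using iterated_frontier_counts[OF V0 VP, of m] markP unfolding n C_def by blast
  have countb: "card (touching (C n) {?b}) = 3 * 2 ^ n"
    using iterated_central_count[OF V0, of m] unfolding n C_def .
  have neP: "touching (C n) ?P \<noteq> {}" and neb: "touching (C n) {?b} \<noteq> {}"
    using countP countb n by auto
  have properP: "\<not> W \<subseteq> ?P" if "W \<in> C n" for W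
    using refine_proper[OF markP[of m], of W] that by (simp add: n C_def)
  have properb: "\<not> W \<subseteq> {?b}" if "W \<in> C n" for W
    using embedded_card[OF C(1) that] card_mono[of "{?b}" W] by auto
  have Out: "\<exists>!K. is_Out n T\<^sub>0 K"
    unfolding Out_iff by (intro collar_unique_cycle(1) C collarP properP neP)
  have Inn: "\<exists>!K. is_Inn n T\<^sub>0 K"
    unfolding Inn_iff by (intro collar_unique_cycle(1) C collarb[of m, folded n] properb neb)
  have is_Out: "is_Out n T\<^sub>0 (Out n T\<^sub>0)" and is_Inn: "is_Inn n T\<^sub>0 (Inn n T\<^sub>0)"
    using theI'[OF Out] theI'[OF Inn] by (simp_all add: Out_def Inn_def)
  have "cycle_length (Out n T\<^sub>0) = card (touching (C n) ?P)"
    using is_Out unfolding Out_iff by (intro collar_unique_cycle(2)[OF C collarP properP neP])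
  moreover have "cycle_length (Inn n T\<^sub>0) = card (touching (C n) {?b})"
    using is_Inn unfolding Inn_iff
    by (intro collar_unique_cycle(2)[OF C collarb[of m, folded n] properb neb])
  ultimately show ?thesis using Out Inn countP countb by simp
qed

end
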